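(* Computing the track-number or layered pathwidth of a graph $G$ is non-uniformly fixed-parameter linear in the tree-depth of $G$. That is, for each fixed integer $d$ there is an algorithm that computes the track-number of any graph of tree-depth at most $d$ in linear time, and there is an algorithm that computes the layered pathwidth of any graph of tree-depth at most $d$ in linear time.
   Context: Graphs are finite, simple and undirected. A problem is non-uniformly fixed-parameter tractable (respectively linear) if there is a collection of algorithms such that for each possible fixed value of the parameter one of the algorithms solves the problem in polynomial (respectively linear) time; the implied constants may depend on the parameter value. The tree-depth of a graph $G$ is the minimum height (number of vertices on a longest root-to-leaf path) of a forest of rooted trees on the same vertex set as $G$ such that edges in $G$ only go from ancestors to descendants in the forest. A $k$-track layout of a graph is a partition of its vertex set into $k$ sequences, called tracks, such that the vertices in each track form an independent set and the edges between each pair of tracks form a non-crossing set; that is, there are no edges $uv$ and $u'v'$ such that $u$ is before $u'$ in one track but $v$ is after $v'$ in another track. The track-number of a graph is the minimum number of tracks in a track layout of it. A path decomposition of a graph is a sequence of vertex subsets (bags) such that each vertex belongs to a nonempty contiguous subsequence of bags and every two adjacent vertices have at least one bag in common. A layering of a graph is a partition of its vertices into a sequence of disjoint subsets (layers) such that each edge joins vertices in the same layer or in consecutive layers. The layered pathwidth of a graph $G$ is the minimum integer $k$ such that for some path decomposition and some layering of $G$, the intersection of each bag with each layer has at most $k$ vertices. *)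

theory Defs
  imports Main
begin

section \<open>Graphs and the three parameters\<close>

definition simple_graph :: "'a set \<Rightarrow> 'a set set \<Rightarrow> bool" where
  "simple_graph V E \<longleftrightarrow> finite V \<and> (\<forall>e\<in>E. e \<subseteq> V \<and> card e = 2)"

text \<open>A forest of rooted trees on \<open>V\<close>, given by its child-to-parent pairs; the roots are the
  vertices without a parent. \<open>(u, v) \<in> F\<^sup>+\<close> means that \<open>v\<close> is a proper ancestor of \<open>u\<close>.\<close>

definition rooted_forest :: "'a set \<Rightarrow> ('a \<times> 'a) set \<Rightarrow> bool" where
  "rooted_forest V F \<longleftrightarrow> F \<subseteq> V \<times> V \<and> single_valued F \<and> acyclic F"

definition root_to_leaf_path :: "'a set \<Rightarrow> ('a \<times> 'a) set \<Rightarrow> 'a list \<Rightarrow> bool" where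
  "root_to_leaf_path V F p \<longleftrightarrow>
     p \<noteq> [] \<and> set p \<subseteq> V \<and> successively (\<lambda>u v. (v, u) \<in> F) p \<and>
     hd p \<notin> Domain F \<and> last p \<notin> Range F"

text \<open>The inserted \<open>0\<close> only matters for the empty forest.\<close>

definition forest_height :: "'a set \<Rightarrow> ('a \<times> 'a) set \<Rightarrow> nat" where
  "forest_height V F = Max (insert 0 {length p | p. root_to_leaf_path V F p})"

definition tree_depth :: "'a set \<Rightarrow> 'a set set \<Rightarrow> nat" where
  "tree_depth V E = (LEAST h. \<exists>F. rooted_forest V F \<and>
     (\<forall>u v. {u, v} \<in> E \<longrightarrow> (u, v) \<in> F\<^sup>+ \<or> (v, u) \<in> F\<^sup>+) \<and> forest_height V F = h)"

definition before :: "'a list \<Rightarrow> 'a \<Rightarrow> 'a \<Rightarrow> bool" where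
  "before xs x y \<longleftrightarrow> (\<exists>i j. i < j \<and> j < length xs \<and> xs ! i = x \<and> xs ! j = y)"

definition track_layout :: "'a set \<Rightarrow> 'a set set \<Rightarrow> 'a list list \<Rightarrow> bool" where
  "track_layout V E T \<longleftrightarrow>
     distinct (concat T) \<and> set (concat T) = V \<and>
     (\<forall>s\<in>set T. \<forall>u\<in>set s. \<forall>v\<in>set s. {u, v} \<notin> E) \<and>
     (\<forall>s\<in>set T. \<forall>t\<in>set T. \<not> (\<exists>u u' v v'.
        {u, v} \<in> E \<and> {u', v'} \<in> E \<and> before s u u' \<and> before t v' v))"

definition track_number :: "'a set \<Rightarrow> 'a set set \<Rightarrow> nat" where
  "track_number V E = (LEAST k. \<exists>T. track_layout V E T \<and> length T = k)"

definition path_decomposition :: "'a set \<Rightarrow> 'a set set \<Rightarrow> 'a set list \<Rightarrow> bool" where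
  "path_decomposition V E B \<longleftrightarrow>
     (\<forall>X\<in>set B. X \<subseteq> V) \<and>
     (\<forall>v\<in>V. \<exists>a b. a \<le> b \<and> {i. i < length B \<and> v \<in> B ! i} = {a..b}) \<and>
     (\<forall>e\<in>E. \<exists>X\<in>set B. e \<subseteq> X)"

definition layering :: "'a set \<Rightarrow> 'a set set \<Rightarrow> 'a set list \<Rightarrow> bool" where
  "layering V E L \<longleftrightarrow>
     \<Union> (set L) = V \<and>
     (\<forall>i j. i < j \<and> j < length L \<longrightarrow> L ! i \<inter> L ! j = {}) \<and>
     (\<forall>u v. {u, v} \<in> E \<longrightarrow> (\<exists>i j. i < length L \<and> j < length L \<and>
        u \<in> L ! i \<and> v \<in> L ! j \<and> i \<le> Suc j \<and> j \<le> Suc i))"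

definition layered_pathwidth :: "'a set \<Rightarrow> 'a set set \<Rightarrow> nat" where
  "layered_pathwidth V E = (LEAST k. \<exists>B L. path_decomposition V E B \<and> layering V E L \<and>
     (\<forall>X\<in>set B. \<forall>Y\<in>set L. card (X \<inter> Y) \<le> k))"


section \<open>Algorithms and their running time\<close>

text \<open>The machine model is a random access machine with logarithmic word size, programmed in a
  structured language. The memory consists of arrays of natural numbers; a program names finitely
  many of them, and cell \<open>0\<close> of an array serves as a scalar variable. Arithmetic is limited to
  addition and truncated subtraction.\<close>

type_synonym memory = "nat \<Rightarrow> nat \<Rightarrow> nat"

datatype aexp = Const nat | Read nat aexp | Add aexp aexp | Sub aexp aexp

datatype bexp = Less aexp aexp | Neg bexp | Conj bexp bexp

datatype com =
    Skip
  | Write nat aexp aexp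
  | Seq com com
  | Cond bexp com com
  | While bexp com

primrec aval :: "aexp \<Rightarrow> memory \<Rightarrow> nat" where
  "aval (Const n) s = n"
| "aval (Read k a) s = s k (aval a s)"
| "aval (Add a b) s = aval a s + aval b s"
| "aval (Sub a b) s = aval a s - aval b s"

primrec bval :: "bexp \<Rightarrow> memory \<Rightarrow> bool" where
  "bval (Less a b) s \<longleftrightarrow> aval a s < aval b s"
| "bval (Neg b) s \<longleftrightarrow> \<not> bval b s"
| "bval (Conj b c) s \<longleftrightarrow> bval b s \<and> bval c s"

text \<open>\<open>exec w c s t s'\<close>: started in \<open>s\<close>, the program \<open>c\<close> halts in \<open>s'\<close> after \<open>t\<close> steps. Every
  assignment and every evaluation of a guard is one step: the expressions in a fixed program have
  bounded size, so counting their operations would change \<open>t\<close> by a constant factor only. Addresses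
  and values written must not exceed \<open>w\<close>, otherwise the program gets stuck and there is no \<open>s'\<close>.
  Without this restriction repeated doubling would produce numbers with linearly many bits
  in linear time.\<close>

inductive exec :: "nat \<Rightarrow> com \<Rightarrow> memory \<Rightarrow> nat \<Rightarrow> memory \<Rightarrow> bool" for w where
  Skip: "exec w Skip s 1 s"
| Write: "aval a s \<le> w \<Longrightarrow> aval b s \<le> w \<Longrightarrow>
    exec w (Write k a b) s 1 (s(k := (s k)(aval a s := aval b s)))"
| Seq: "exec w c s t s' \<Longrightarrow> exec w d s' t' s'' \<Longrightarrow> exec w (Seq c d) s (t + t') s''"
| CondTrue: "bval b s \<Longrightarrow> exec w c s t s' \<Longrightarrow> exec w (Cond b c d) s (Suc t) s'"
| CondFalse: "\<not> bval b s \<Longrightarrow> exec w d s t s' \<Longrightarrow> exec w (Cond b c d) s (Suc t) s'"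
| WhileFalse: "\<not> bval b s \<Longrightarrow> exec w (While b c) s 1 s"
| WhileTrue: "bval b s \<Longrightarrow> exec w c s t s' \<Longrightarrow> exec w (While b c) s' t' s'' \<Longrightarrow>
    exec w (While b c) s (Suc (t + t')) s''"

lemma exec_deterministic:
  "exec w c s t s' \<Longrightarrow> exec w c s u s'' \<Longrightarrow> t = u \<and> s' = s''"
proof (induction arbitrary: u s'' rule: exec.induct)
  case (Seq c s t s' d t' s1)
  from Seq.prems show ?case
    by cases (use Seq.IH in blast)
next
  case (WhileTrue b s c t s' t' s1)
  from WhileTrue.prems show ?case
    by cases (use WhileTrue in blast)+
qed (erule exec.cases; blast)+

text \<open>Adjacency lists, in arbitrary order, of the graph whose vertices are numbered
  \<open>0, ..., n - 1\<close> according to their position in \<open>vs\<close>.\<close>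

definition adjacency_lists :: "'a set \<Rightarrow> 'a set set \<Rightarrow> 'a list \<Rightarrow> nat list list \<Rightarrow> bool" where
  "adjacency_lists V E vs adj \<longleftrightarrow>
     distinct vs \<and> set vs = V \<and> length adj = length vs \<and>
     (\<forall>i < length vs. distinct (adj ! i) \<and>
        set (adj ! i) = {j. j < length vs \<and> {vs ! i, vs ! j} \<in> E})"

definition array_of :: "nat list \<Rightarrow> nat \<Rightarrow> nat" where
  "array_of xs i = (if i < length xs then xs ! i else 0)"

text \<open>Array \<open>0\<close> holds the number of vertices, array \<open>2\<close> the concatenated adjacency lists, and
  array \<open>1\<close> their boundaries: the neighbours of \<open>i\<close> are in the cells from \<open>s 1 i\<close> up to but
  excluding \<open>s 1 (i + 1)\<close> of array \<open>2\<close>. All other cells are \<open>0\<close>.\<close>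

definition input_memory :: "nat list list \<Rightarrow> memory" where
  "input_memory adj = (\<lambda>_ _. 0)
     (0 := array_of [length adj],
      1 := array_of (map (\<lambda>i. length (concat (take i adj))) [0..<Suc (length adj)]),
      2 := array_of (concat adj))"

text \<open>The vertices are natural numbers because a type variable could not be quantified inside
  the existential quantifier over programs; every finite graph has an isomorphic copy of this
  kind. The result is read from cell \<open>0\<close> of array \<open>3\<close>. The word bound
  \<open>(N + 2) ^ c\<close> amounts to words of \<open>O(log N)\<close> bits.\<close>

definition linear_time_computable_on ::
  "(nat set \<Rightarrow> nat set set \<Rightarrow> bool) \<Rightarrow> (nat set \<Rightarrow> nat set set \<Rightarrow> nat) \<Rightarrow> bool" where
  "linear_time_computable_on C f \<longleftrightarrow>
     (\<exists>P c. \<forall>V E vs adj. simple_graph V E \<longrightarrow> C V E \<longrightarrow> adjacency_lists V E vs adj \<longrightarrow>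
        (let N = card V + card E in
         \<exists>t s. exec ((N + 2) ^ c) P (input_memory adj) t s \<and> t \<le> c * (N + 1) \<and> s 3 0 = f V E))"

definition nonuniformly_fixed_parameter_linear ::
  "(nat set \<Rightarrow> nat set set \<Rightarrow> nat) \<Rightarrow> (nat set \<Rightarrow> nat set set \<Rightarrow> nat) \<Rightarrow> bool" where
  "nonuniformly_fixed_parameter_linear param f \<longleftrightarrow>
     (\<forall>d. linear_time_computable_on (\<lambda>V E. param V E \<le> d) f)"

end

theory Submission
  imports Defs "HOL-Library.Ramsey"
begin

text \<open>A graph of tree-depth at most \<open>d\<close> has no path with \<open>2 ^ d\<close> vertices
  (\<open>tree_depth_path_length\<close>), so the depth-first search trees of its components are
  bounded in height. Every edge joins an ancestor and a descendant in such a tree. A run of the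
  search is therefore recorded completely by a term of type \<open>tree\<close> of bounded
  height: where it descends and where it meets an edge that leads back to an ancestor. Two terms
  that agree up to the names of the vertices describe isomorphic graphs.

  Terms of bounded height are well-quasi-ordered by the embedding that maps the root to the root
  and the steps at a vertex to a subsequence of the steps at its image
  (\<open>embeds_wqo\<close>). For children this is Higman's lemma, and the bound on the height
  allows an induction. An embedding of terms induces an embedding of the graphs
  (\<open>embedding_map\<close>). The track-number and the layered pathwidth do not increase
  when one passes to a subgraph, and they are bounded in terms of the height. For each of the
  finitely many thresholds, well-quasi-ordering therefore yields a size \<open>S\<close> such
  that the parameter of a term reaches the threshold exactly if this already holds for a term of
  size at most \<open>S\<close> that embeds into it. The set of the terms of size at most
  \<open>S\<close>, up to the names of the vertices, that embed into a term is thus a finite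
  amount of information that determines the parameter. This set can be computed bottom-up,
  because the set of a compound term depends only on the sets of its parts. The parameter is
  thus the output of a finite tree automaton (\<open>finite_state_evaluation\<close>). This is
  where non-uniformity enters: the argument does not tell how to find \<open>S\<close>.

  The program runs a depth-first search and updates at every step the state of the automaton for
  each vertex on the current search path. As the height is bounded, the recursion is unrolled
  into nested loops, and the transition tables are constant and become case distinctions. A
  vertex costs constant time plus constant time for each entry of its adjacency list
  (\<open>visit_correct\<close>), hence the linear bound.\<close>

section \<open>Well-quasi-order on terms that record a depth-first search\<close>

text \<open>A term records what a search has done at a vertex and below it, in chronological
  order. It starts with \<open>Node v\<close>; \<open>Link t j\<close> appends the discovery of
  an edge from the root of \<open>t\<close> to its ancestor at depth \<open>j\<close>;
  \<open>Hang t c\<close> appends the exploration of a new child, with record \<open>c\<close>.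
  A vertex with its whole list of children is thus built by adding one child at a time, which is
  how the program will build it.\<close>

datatype 'v tree = Node 'v | Link "'v tree" nat | Hang "'v tree" "'v tree"

text \<open>The root goes to the root, the steps of the root to a subsequence of the steps of
  its image, and every child recursively to a child. The names of the vertices are irrelevant,
  so that terms over different types can be compared.\<close>

primrec embeds :: "'a tree \<Rightarrow> 'b tree \<Rightarrow> bool" where
  "embeds m (Node v) \<longleftrightarrow> (\<exists>u. m = Node u)"
| "embeds m (Link t j) \<longleftrightarrow> embeds m t \<or> (\<exists>m'. m = Link m' j \<and> embeds m' t)"
| "embeds m (Hang t c) \<longleftrightarrow> embeds m t \<or> (\<exists>m' n. m = Hang m' n \<and> embeds m' t \<and> embeds n c)"

text \<open>The index of an edge counts towards the weight so that, up to the names of the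
  vertices, there are only finitely many terms of each weight.\<close>

primrec weight :: "'v tree \<Rightarrow> nat" where
  "weight (Node v) = 0"
| "weight (Link t j) = Suc (weight t + j)"
| "weight (Hang t c) = Suc (weight t + weight c)"

text \<open>The root of the term is at depth \<open>i\<close> of the whole tree and has at most
  \<open>k\<close> further levels below it.\<close>

primrec bounded_tree :: "nat \<Rightarrow> nat \<Rightarrow> 'v tree \<Rightarrow> bool" where
  "bounded_tree k i (Node v) \<longleftrightarrow> True"
| "bounded_tree k i (Link t j) \<longleftrightarrow> bounded_tree k i t \<and> j < i"
| "bounded_tree k i (Hang t c) \<longleftrightarrow> bounded_tree k i t \<and> 0 < k \<and> bounded_tree (k - 1) (Suc i) c"

lemma embeds_Node: "embeds (Node u) t"
  by (induction t) auto

definition bad :: "(nat \<Rightarrow> 'v tree) \<Rightarrow> bool" where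
  "bad g \<longleftrightarrow> (\<forall>p q. p < q \<longrightarrow> \<not> embeds (g p) (g q))"

text \<open>By Ramsey's theorem: colour the pairs \<open>p < q\<close> of indices by whether
  \<open>R (x p) (x q)\<close> holds. On an infinite homogeneous set the relation holds always
  or never, and the latter contradicts the hypothesis.\<close>

lemma ascending_subsequence:
  fixes R :: "'a \<Rightarrow> 'a \<Rightarrow> bool" and x :: "nat \<Rightarrow> 'a"
  assumes good: "\<And>g :: nat \<Rightarrow> 'a. \<forall>n. g n \<in> A \<Longrightarrow> \<exists>p q. p < q \<and> R (g p) (g q)"
    and x: "\<And>n. n \<in> N \<Longrightarrow> x n \<in> A" and N: "infinite N"
  shows "\<exists>r :: nat \<Rightarrow> nat. strict_mono r \<and> range r \<subseteq> N \<and> (\<forall>p q :: nat. p < q \<longrightarrow> R (x (r p)) (x (r q)))"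
proof -
  define col where "col = (\<lambda>e::nat set. if R (x (Min e)) (x (Max e)) then 0 else 1::nat)"
  have "\<forall>a\<in>N. \<forall>b\<in>N. a \<noteq> b \<longrightarrow> col {a, b} < 2"
    by (auto simp: col_def)
  from Ramsey2[OF N this] obtain Y t where Y: "Y \<subseteq> N" "infinite Y" "t < 2"
    "\<forall>a\<in>Y. \<forall>b\<in>Y. a \<noteq> b \<longrightarrow> col {a, b} = t" by blast
  define r where "r = enumerate Y"
  have r: "strict_mono r" "\<And>n. r n \<in> Y"
    using Y(2) by (simp_all add: r_def strict_mono_enumerate enumerate_in_set)
  have col: "col {r p, r q} = (if R (x (r p)) (x (r q)) then 0 else 1)" if "p < q" for p q
    using strict_monoD[OF r(1) that] by (simp add: col_def)
  obtain p q where pq: "p < q" "R (x (r p)) (x (r q))"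
    using good[of "x \<circ> r"] r(2) Y(1) x by (auto simp: subset_eq)
  have "r p \<noteq> r q"
    using strict_monoD[OF r(1) pq(1)] by simp
  then have t: "t = 0"
    using col[OF pq(1)] pq(2) Y(4) r(2)[of p] r(2)[of q] by simp
  have "R (x (r a)) (x (r b))" if "a < b" for a b
  proof -
    have "r a \<noteq> r b"
      using strict_monoD[OF r(1) that] by simp
    then have "col {r a, r b} = 0"
      using Y(4) r(2)[of a] r(2)[of b] t by simp
    then show ?thesis
      using col[OF that] by (metis zero_neq_one)
  qed
  moreover have "range r \<subseteq> N"
    using r(2) Y(1) by auto
  ultimately have "strict_mono r \<and> range r \<subseteq> N \<and> (\<forall>p q :: nat. p < q \<longrightarrow> R (x (r p)) (x (r q)))"
    using r(1) by simp
  then show ?thesis by (intro exI[of _ r])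
qed

text \<open>The sequence of Nash-Williams: choose each element of least possible weight among
  those for which the elements chosen so far can still be continued to a bad sequence.\<close>

lemma minimal_bad_sequence:
  fixes P :: "'v tree \<Rightarrow> bool"
  assumes "bad g" "\<forall>n. P (g n)"
  shows "\<exists>m. bad m \<and> (\<forall>n. P (m n)) \<and>
    (\<forall>n h. bad h \<longrightarrow> (\<forall>i. P (h i)) \<longrightarrow> (\<forall>i<n. h i = m i) \<longrightarrow> weight (m n) \<le> weight (h n))"
proof -
  define ext where "ext xs h \<longleftrightarrow> bad h \<and> (\<forall>i. P (h i)) \<and> (\<forall>i<length xs. h i = xs ! i)"
    for xs :: "'v tree list" and h
  define Q where "Q xs x \<longleftrightarrow> (\<exists>h. ext (xs @ [x]) h)" for xs x
  define pre where "pre = rec_nat [] (\<lambda>_ xs. xs @ [arg_min weight (Q xs)])"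
  define m where "m n = arg_min weight (Q (pre n))" for n
  have pre_0: "pre 0 = []" and pre_Suc: "pre (Suc n) = pre n @ [m n]" for n
    by (simp_all add: pre_def m_def)
  have len: "length (pre n) = n" for n
    by (induction n) (simp_all add: pre_0 pre_Suc)
  have nth: "pre n ! i = m i" if "i < n" for i n
    using that by (induction n) (auto simp: pre_Suc nth_append len less_Suc_eq)
  have step: "Q xs (h (length xs))" if "ext xs h" for xs h
    using that unfolding Q_def ext_def by (intro exI[of _ h]) (auto simp: nth_append less_Suc_eq)
  have ex: "\<exists>h. ext (pre n) h" for n
  proof (induction n)
    case 0
    then show ?case using assms by (auto simp: ext_def pre_0)
  next
    case (Suc n)
    then have "Q (pre n) (m n)"
      unfolding m_def using step arg_min_natI[of "Q (pre n)" _ weight] by blast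
    then show ?case by (simp add: Q_def pre_Suc)
  qed
  have least: "weight (m n) \<le> weight (h n)"
    if "bad h" "\<forall>i. P (h i)" "\<forall>i<n. h i = m i" for n h
  proof -
    have "ext (pre n) h"
      using that by (simp add: ext_def len nth)
    from step[OF this] show ?thesis
      by (simp add: m_def len arg_min_nat_le)
  qed
  have "\<not> embeds (m p) (m q)" if "p < q" for p q
  proof -
    obtain h where "ext (pre (Suc q)) h" using ex by blast
    then have "bad h" "h p = m p" "h q = m q"
      using that by (auto simp: ext_def len nth)
    then show ?thesis using that by (metis bad_def)
  qed
  moreover have "P (m n)" for n
  proof -
    obtain h where "ext (pre (Suc n)) h" using ex by blast
    then show ?thesis
      by (metis ext_def len lessI nth)
  qed
  ultimately show ?thesis
    using least by (intro exI[of _ m]) (auto simp: bad_def)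
qed

text \<open>Induction on the height. Given a minimal bad sequence, infinitely many of its terms
  end with the same kind of step: with the same edge, or with children that form an ascending
  sequence, because the children are well-quasi-ordered by the induction hypothesis. Undoing the
  last step in these terms gives a bad sequence again, which contradicts minimality. No term is
  a single node, as a node embeds into every term.\<close>

theorem embeds_wqo:
  fixes g :: "nat \<Rightarrow> 'v tree"
  assumes "\<forall>n. bounded_tree k i (g n)"
  shows "\<exists>p q. p < q \<and> embeds (g p) (g q)"
  using assms
proof (induction k arbitrary: i g rule: less_induct)
  case (less k)
  show ?case
  proof (rule ccontr)
    assume "\<not> ?thesis"
    then have "bad g" by (auto simp: bad_def)
    from minimal_bad_sequence[OF this less.prems] obtain m where m: "bad m" "\<forall>n. bounded_tree k i (m n)"
      and least: "\<forall>n (h :: nat \<Rightarrow> 'v tree). bad h \<longrightarrow> (\<forall>j. bounded_tree k i (h j)) \<longrightarrow> (\<forall>j<n. h j = m j) \<longrightarrow>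
        weight (m n) \<le> weight (h n)"
      by (elim exE conjE)
    \<comment> \<open>Replacing the tail from \<open>r 0\<close> on by the shortened terms would give a smaller bad sequence.\<close>
    have shorten: False if r: "strict_mono r"
      and u: "\<And>n. bounded_tree k i (u n)" "\<And>n. weight (u n) < weight (m (r n))"
        "\<And>(t :: 'v tree) n. embeds t (u n) \<Longrightarrow> embeds t (m (r n))"
      and up: "\<And>p q. p < q \<Longrightarrow> embeds (u p) (u q) \<Longrightarrow> embeds (m (r p)) (m (r q))"
      for r and u :: "nat \<Rightarrow> 'v tree"
    proof -
      define h where "h n = (if n < r 0 then m n else u (n - r 0))" for n
      have "\<not> embeds (h p) (h q)" if "p < q" for p q
      proof -
        consider "q < r 0" | "p < r 0" "r 0 \<le> q" | "r 0 \<le> p" using \<open>p < q\<close> by linarith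
        then show ?thesis
        proof cases
          case 1
          then show ?thesis using m(1) that by (simp add: h_def bad_def)
        next
          case 2
          have "r 0 \<le> r (q - r 0)"
            using r by (simp add: strict_mono_less_eq)
          then have "p < r (q - r 0)" using 2 by simp
          then show ?thesis using m(1) u(3) 2 by (auto simp: h_def bad_def)
        next
          case 3
          then have "p - r 0 < q - r 0" using that by simp
          moreover have "r (p - r 0) < r (q - r 0)"
            using r calculation by (simp add: strict_mono_less)
          ultimately show ?thesis using up m(1) 3 that by (auto simp: h_def bad_def)
        qed
      qed
      then have "bad h" by (simp add: bad_def)
      moreover have "\<forall>n. bounded_tree k i (h n)" using m(2) u(1) by (simp add: h_def)
      ultimately have "weight (m (r 0)) \<le> weight (h (r 0))"
        using least[rule_format, of h "r 0"] by (simp add: h_def)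
      with u(2)[of 0] show False by (simp add: h_def)
    qed
    have "\<not> (\<exists>v. m n = Node v)" for n
      using m(1) embeds_Node unfolding bad_def by (metis lessI)
    then have "UNIV = (\<Union>j<i. {n. \<exists>t. m n = Link t j}) \<union> {n. \<exists>t c. m n = Hang t c}"
    proof -
      have "(\<exists>j<i. \<exists>t. m n = Link t j) \<or> (\<exists>t c. m n = Hang t c)" for n
        using \<open>\<And>n. \<not> (\<exists>v. m n = Node v)\<close>[of n] m(2)[rule_format, of n] by (cases "m n") auto
      then show ?thesis by blast
    qed
    then have "infinite ((\<Union>j<i. {n. \<exists>t. m n = Link t j}) \<union> {n. \<exists>t c. m n = Hang t c})"
      by (metis infinite_UNIV_nat)
    then consider j where "infinite {n. \<exists>t. m n = Link t j}" | "infinite {n. \<exists>t c. m n = Hang t c}"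
      by auto
    then show False
    proof cases
      case 1
      define r where "r = enumerate {n. \<exists>t. m n = Link t j}"
      have r: "strict_mono r" "\<And>n. \<exists>t. m (r n) = Link t j"
        using strict_mono_enumerate[OF 1] enumerate_in_set[OF 1] by (auto simp: r_def)
      then obtain u where u: "\<And>n. m (r n) = Link (u n) j" by metis
      show False
      proof (rule shorten[OF r(1), of u])
        show "bounded_tree k i (u n)" for n using m(2)[rule_format, of "r n"] u by simp
      qed (auto simp: u)
    next
      case 2
      define N where "N = {n. \<exists>t c. m n = Hang t c}"
      define c where "c n = (SOME c. \<exists>t. m n = Hang t c)" for n
      have c: "\<exists>t. m n = Hang t (c n)" if "n \<in> N" for n
        using that unfolding N_def c_def by (metis (mono_tags, lifting) mem_Collect_eq someI_ex)
      have "\<exists>n. n \<in> N" using 2 by (metis N_def finite.emptyI ex_in_conv)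
      then have k: "0 < k" using c m(2) by (metis bounded_tree.simps(3))
      have c': "c n \<in> {t. bounded_tree (k - 1) (Suc i) t}" if "n \<in> N" for n
        using c[OF that] m(2) by (metis bounded_tree.simps(3) mem_Collect_eq)
      have "\<exists>r :: nat \<Rightarrow> nat. strict_mono r \<and> range r \<subseteq> N \<and>
          (\<forall>p q. p < q \<longrightarrow> embeds (c (r p)) (c (r q)))"
      proof (rule ascending_subsequence[where A = "{t. bounded_tree (k - 1) (Suc i) t}"])
        show "\<exists>p q. p < q \<and> embeds (g p) (g q)"
          if "\<forall>n. g n \<in> {t. bounded_tree (k - 1) (Suc i) t}" for g :: "nat \<Rightarrow> 'v tree"
          using less.IH[of "k - 1" "Suc i" g] that k by simp
      qed (use c' 2 in \<open>simp_all add: N_def\<close>)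
      then obtain r :: "nat \<Rightarrow> nat" where r: "strict_mono r" "range r \<subseteq> N"
        "\<forall>p q. p < q \<longrightarrow> embeds (c (r p)) (c (r q))"
        by blast
      then have "\<exists>t. m (r n) = Hang t (c (r n))" for n using c by (simp add: range_subsetD)
      then obtain u where u: "\<And>n. m (r n) = Hang (u n) (c (r n))" by metis
      show False
      proof (rule shorten[OF r(1), of u])
        show "bounded_tree k i (u n)" for n using m(2)[rule_format, of "r n"] u by simp
      qed (use r(3) in \<open>auto simp: u\<close>)
    qed
  qed
qed

section \<open>Finite-state evaluation of monotone parameters\<close>

text \<open>Up to the names of the vertices, \<open>U\<close> has only finitely many minimal
  terms. Otherwise each \<open>S\<close> has a counterexample \<open>T S\<close>, and one can
  choose the bounds so that each exceeds the weights of all counterexamples before it. Then no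
  counterexample embeds into a later one, contrary to well-quasi-ordering.\<close>

lemma bounded_obstructions:
  fixes U :: "'v tree set"
  assumes U: "\<And>t. t \<in> U \<Longrightarrow> bounded_tree k i t"
  shows "\<exists>S. \<forall>t\<in>U. \<exists>m\<in>U. weight m \<le> S \<and> embeds m t"
proof (rule ccontr)
  assume "\<not> ?thesis"
  then have "\<forall>S. \<exists>t\<in>U. \<forall>m\<in>U. weight m \<le> S \<longrightarrow> \<not> embeds m t" by blast
  then obtain T where T: "\<And>S. T S \<in> U" "\<And>S m. m \<in> U \<Longrightarrow> weight m \<le> S \<Longrightarrow> \<not> embeds m (T S)"
    by metis
  define h where "h = rec_nat 0 (\<lambda>_ s. s + weight (T s))"
  have h_Suc: "h (Suc n) = h n + weight (T (h n))" for n by (simp add: h_def)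
  have "mono h" by (rule mono_iff_le_Suc[THEN iffD2]) (simp add: h_Suc)
  obtain p q where pq: "p < q" "embeds (T (h p)) (T (h q))"
    using embeds_wqo[of k i "\<lambda>n. T (h n)"] T(1) U by blast
  have "weight (T (h p)) \<le> h (Suc p)" by (simp add: h_Suc)
  also have "\<dots> \<le> h q" using \<open>mono h\<close> pq(1) by (simp add: monoD Suc_leI)
  finally show False using T pq(2) by blast
qed

lemma finite_weight: "finite {m :: unit tree. weight m \<le> S}"
proof (induction S)
  case 0
  have "m = Node ()" if "weight m = 0" for m :: "unit tree"
    using that by (cases m) auto
  then have "{m :: unit tree. weight m \<le> 0} \<subseteq> {Node ()}" by auto
  then show ?case by (rule finite_subset) simp
next
  case (Suc S)
  let ?X = "{m :: unit tree. weight m \<le> S}"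
  have "m \<in> insert (Node ()) (case_prod Link ` (?X \<times> {..S}) \<union> case_prod Hang ` (?X \<times> ?X))"
    if "weight m \<le> Suc S" for m :: "unit tree"
    using that by (cases m) force+
  then have "{m :: unit tree. weight m \<le> Suc S} \<subseteq>
      insert (Node ()) (case_prod Link ` (?X \<times> {..S}) \<union> case_prod Hang ` (?X \<times> ?X))" by blast
  then show ?case by (rule finite_subset) (use Suc in simp)
qed

abbreviation shape :: "'v tree \<Rightarrow> unit tree" where
  "shape \<equiv> map_tree (\<lambda>_. ())"

lemma weight_shape: "weight (shape t) = weight t"
  by (induction t) auto

lemma shape_eq_iff:
  "shape m = Node u \<longleftrightarrow> (\<exists>v. m = Node v)"
  "shape m = Link s j \<longleftrightarrow> (\<exists>t. m = Link t j \<and> shape t = s)"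
  "shape m = Hang s r \<longleftrightarrow> (\<exists>t c. m = Hang t c \<and> shape t = s \<and> shape c = r)"
  by (cases m; auto)+

lemma embeds_shape: "embeds (shape m) t \<longleftrightarrow> embeds m t"
  by (induction t arbitrary: m) (auto simp: shape_eq_iff)

text \<open>The state of a term is the set of shapes of weight at most \<open>S\<close> that
  embed into it, where \<open>S\<close> bounds the obstructions for all thresholds up to
  \<open>B\<close>; the states are numbered by \<open>e\<close>. Membership in the state of
  \<open>Link t j\<close> or \<open>Hang t c\<close> is decided by the parts of the embedded
  shape, which have smaller weight, so the states of the parts suffice. The value of
  \<open>F\<close> is the maximum over all terms whose shape is in the state: none of them
  exceeds it by monotonicity, and the obstruction for the threshold \<open>F t\<close> attains
  it.\<close>

theorem finite_state_evaluation:
  fixes F :: "'v tree \<Rightarrow> nat"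
  assumes bounded: "\<And>t. A t \<Longrightarrow> bounded_tree k i t"
    and mono: "\<And>t t'. A t \<Longrightarrow> A t' \<Longrightarrow> embeds t' t \<Longrightarrow> F t' \<le> F t"
    and bound: "\<And>t. A t \<Longrightarrow> F t \<le> B"
  obtains K :: nat and code :: "'v tree \<Rightarrow> nat" and node link hang out
  where "\<And>t. code t < K" "\<And>v. code (Node v) = node" "\<And>t j. code (Link t j) = link (code t) j"
    "\<And>t c. code (Hang t c) = hang (code t) (code c)" "\<And>t. A t \<Longrightarrow> out (code t) = F t"
proof -
  define U where "U b = {t. A t \<and> b \<le> F t}" for b
  have "\<exists>S. \<forall>t\<in>U b. \<exists>m\<in>U b. weight m \<le> S \<and> embeds m t" for b
    by (rule bounded_obstructions[of _ k i]) (simp add: U_def bounded)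
  then obtain s where s: "\<And>b t. t \<in> U b \<Longrightarrow> \<exists>m\<in>U b. weight m \<le> s b \<and> embeds m t" by metis
  define S where "S = (\<Sum>b\<le>B. s b)"
  have witness: "\<exists>m. A m \<and> weight m \<le> S \<and> embeds m t \<and> F t \<le> F m" if "A t" for t
  proof -
    have "t \<in> U (F t)" using that by (simp add: U_def)
    from s[OF this] obtain m where m: "m \<in> U (F t)" "weight m \<le> s (F t)" "embeds m t" by blast
    have "s (F t) \<le> S"
      unfolding S_def using bound[OF that] by (intro member_le_sum) auto
    then show ?thesis using m by (auto simp: U_def)
  qed
  define sig where "sig t = {m :: unit tree. weight m \<le> S \<and> embeds m t}" for t :: "'v tree"
  define Q where "Q = Pow {m :: unit tree. weight m \<le> S}"
  have Q: "sig t \<in> Q" for t by (auto simp: sig_def Q_def)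
  have "finite Q" by (simp add: Q_def finite_weight)
  then obtain e where e: "bij_betw e Q {0..<card Q}" using ex_bij_betw_finite_nat by blast
  define d where "d = inv_into Q e"
  have d: "d (e (sig t)) = sig t" for t
    using e Q by (simp add: d_def bij_betw_inv_into_left)
  define link where "link a j = e (d a \<union> {Link m j | m. m \<in> d a \<and> weight (Link m j) \<le> S})" for a j
  define hang where
    "hang a b = e (d a \<union> {Hang m n | m n. m \<in> d a \<and> n \<in> d b \<and> weight (Hang m n) \<le> S})" for a b
  define out where "out a = Max (insert 0 {F t | t. A t \<and> shape t \<in> d a})" for a
  show thesis
  proof (rule that[of "\<lambda>t. e (sig t)" "card Q" "e {Node ()}" link hang out])
    show "e (sig t) < card Q" for t
      using bij_betw_apply[OF e Q[of t]] by simp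
    show "e (sig (Node v)) = e {Node ()}" for v
      by (rule arg_cong[of _ _ e]) (auto simp: sig_def)
    show "e (sig (Link t j)) = link (e (sig t)) j" for t j
      unfolding link_def d by (rule arg_cong[of _ _ e]) (auto simp: sig_def)
    show "e (sig (Hang t c)) = hang (e (sig t)) (e (sig c))" for t c
      unfolding hang_def d by (rule arg_cong[of _ _ e]) (auto simp: sig_def)
    show "out (e (sig t)) = F t" if "A t" for t
      unfolding out_def d
    proof (rule Max_eqI)
      have "insert 0 {F u | u. A u \<and> shape u \<in> sig t} \<subseteq> {..F t}"
        using mono[OF that] by (auto simp: sig_def embeds_shape)
      then show "finite (insert 0 {F u | u. A u \<and> shape u \<in> sig t})"
        and "y \<in> insert 0 {F u | u. A u \<and> shape u \<in> sig t} \<Longrightarrow> y \<le> F t" for y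
        by (auto intro: finite_subset)
      obtain m where m: "A m" "weight m \<le> S" "embeds m t" "F t \<le> F m"
        using witness[OF \<open>A t\<close>] by blast
      then have "F m = F t" using mono[OF that m(1,3)] by simp
      moreover have "shape m \<in> sig t"
        using m(2,3) by (simp add: sig_def embeds_shape weight_shape)
      ultimately show "F t \<in> insert 0 {F u | u. A u \<and> shape u \<in> sig t}"
        using m(1) by (intro insertI2 CollectI exI[of _ m]) simp
    qed
  qed
qed

section \<open>The graph recorded by a term\<close>

primrec root :: "'v tree \<Rightarrow> 'v" where
  "root (Node v) = v"
| "root (Link t j) = root t"
| "root (Hang t c) = root t"

primrec verts :: "'v tree \<Rightarrow> 'v set" where
  "verts (Node v) = {v}"
| "verts (Link t j) = verts t"
| "verts (Hang t c) = verts t \<union> verts c"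

primrec distinct_tree :: "'v tree \<Rightarrow> bool" where
  "distinct_tree (Node v) \<longleftrightarrow> True"
| "distinct_tree (Link t j) \<longleftrightarrow> distinct_tree t"
| "distinct_tree (Hang t c) \<longleftrightarrow> distinct_tree t \<and> distinct_tree c \<and> verts t \<inter> verts c = {}"

text \<open>\<open>anc\<close> lists the proper ancestors of the root, the topmost first; edges
  to them are included.\<close>

primrec edges :: "'v list \<Rightarrow> 'v tree \<Rightarrow> 'v set set" where
  "edges anc (Node v) = {}"
| "edges anc (Link t j) = insert {root t, anc ! j} (edges anc t)"
| "edges anc (Hang t c) = edges anc t \<union> edges (anc @ [root t]) c"

lemma root_in_verts [simp]: "root t \<in> verts t"
  by (induction t) auto

lemma finite_verts [simp]: "finite (verts t)"
  by (induction t) auto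

lemma edges_cases:
  assumes "e \<in> edges anc t" "bounded_tree k (length anc) t"
  shows "\<exists>u\<in>verts t. \<exists>v\<in>verts t \<union> set anc. e = {u, v}"
  using assms
proof (induction t arbitrary: anc k)
  case (Link t j)
  show ?case
  proof (cases "e = {root t, anc ! j}")
    case True
    then show ?thesis
      using Link.prems(2) by (intro bexI[of _ "root t"] bexI[of _ "anc ! j"]) auto
  next
    case False
    then show ?thesis using Link.IH[of anc k] Link.prems by simp
  qed
next
  case (Hang t c)
  show ?case
  proof (cases "e \<in> edges anc t")
    case True
    then show ?thesis using Hang.IH(1)[of anc k] Hang.prems(2) by auto
  next
    case False
    then have "\<exists>u\<in>verts c. \<exists>v\<in>verts c \<union> set (anc @ [root t]). e = {u, v}"
      using Hang.IH(2)[of "anc @ [root t]" "k - 1"] Hang.prems by simp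
    then obtain u v where "u \<in> verts c" "v \<in> verts c \<union> set (anc @ [root t])" "e = {u, v}"
      by blast
    then show ?thesis using root_in_verts[of t]
      by (intro bexI[of _ u] bexI[of _ v]) auto
  qed
qed simp

lemma edges_subset:
  assumes "e \<in> edges anc t" "bounded_tree k (length anc) t"
  shows "e \<subseteq> verts t \<union> set anc"
  using edges_cases[OF assms] by auto

lemma edges_simple:
  assumes "e \<in> edges anc t" "bounded_tree k (length anc) t" "distinct_tree t"
    "set anc \<inter> verts t = {}"
  shows "card e = 2"
  using assms
proof (induction t arbitrary: anc k)
  case (Link t j)
  have "root t \<noteq> anc ! j"
    using Link.prems(2,4) nth_mem[of j anc] root_in_verts[of t]
    by (metis IntI bounded_tree.simps(2) empty_iff verts.simps(2))
  then show ?case using Link by auto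
next
  case (Hang t c)
  have "root t \<notin> verts c" using Hang.prems(3) by (auto simp: disjoint_iff)
  then have "set (anc @ [root t]) \<inter> verts c = {}" using Hang.prems(4) by auto
  moreover have "bounded_tree (k - 1) (length (anc @ [root t])) c" using Hang.prems(2) by simp
  ultimately show ?case
    using Hang.prems Hang.IH(1)[of anc k] Hang.IH(2)[of "anc @ [root t]" "k - 1"] by auto
qed simp

text \<open>The map is built along the embedding of terms. It is prescribed on the ancestors by
  \<open>\<chi>\<close> because a child is embedded after its ancestors, and its edges to them
  have to be respected.\<close>

lemma embedding_map:
  assumes "embeds m t" "bounded_tree k (length anc) m" "length anc' = length anc"
    "distinct_tree m" "distinct_tree t" "set anc \<inter> verts m = {}" "map \<chi> anc = anc'"
  shows "\<exists>\<phi>. (\<forall>x\<in>set anc. \<phi> x = \<chi> x) \<and> inj_on \<phi> (verts m) \<and> \<phi> ` verts m \<subseteq> verts t \<and>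
    \<phi> (root m) = root t \<and> (\<forall>e\<in>edges anc m. \<phi> ` e \<in> edges anc' t)"
  using assms
proof (induction t arbitrary: m anc anc' \<chi> k)
  case (Node v)
  then obtain u where "m = Node u" by auto
  then show ?case using Node.prems by (intro exI[of _ "\<chi>(u := v)"]) auto
next
  case (Link t j)
  show ?case
  proof (cases "embeds m t")
    case True
    then show ?thesis using Link.IH[of m k anc anc' \<chi>] Link.prems by fastforce
  next
    case False
    then obtain m' where m: "m = Link m' j" "embeds m' t" using Link.prems(1) by auto
    then obtain \<phi> where \<phi>: "\<forall>x\<in>set anc. \<phi> x = \<chi> x" "inj_on \<phi> (verts m')"
      "\<phi> ` verts m' \<subseteq> verts t" "\<phi> (root m') = root t" "\<forall>e\<in>edges anc m'. \<phi> ` e \<in> edges anc' t"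
      using Link.IH[of m' k anc anc' \<chi>] Link.prems by auto
    have "\<phi> (anc ! j) = anc' ! j" using \<phi>(1) Link.prems(2,7) m(1) by auto
    then show ?thesis using \<phi> m(1) by (intro exI[of _ \<phi>]) auto
  qed
next
  case (Hang t c)
  show ?case
  proof (cases "embeds m t")
    case True
    then obtain \<phi> where "\<forall>x\<in>set anc. \<phi> x = \<chi> x" "inj_on \<phi> (verts m)"
      "\<phi> ` verts m \<subseteq> verts t" "\<phi> (root m) = root t" "\<forall>e\<in>edges anc m. \<phi> ` e \<in> edges anc' t"
      using Hang.IH(1)[of m k anc anc' \<chi>] Hang.prems by auto
    then show ?thesis by (intro exI[of _ \<phi>]) auto
  next
    case False
    then obtain m' n where m: "m = Hang m' n" "embeds m' t" "embeds n c" using Hang.prems(1) by auto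
    then obtain \<phi> where \<phi>: "\<forall>x\<in>set anc. \<phi> x = \<chi> x" "inj_on \<phi> (verts m')"
      "\<phi> ` verts m' \<subseteq> verts t" "\<phi> (root m') = root t" "\<forall>e\<in>edges anc m'. \<phi> ` e \<in> edges anc' t"
      using Hang.IH(1)[of m' k anc anc' \<chi>] Hang.prems by (auto simp: Int_Un_distrib)
    have "root m' \<notin> verts n" using Hang.prems(4) m(1) by (auto simp: disjoint_iff)
    then have dj: "set (anc @ [root m']) \<inter> verts n = {}" using Hang.prems(6) m(1) by auto
    have "map \<phi> (anc @ [root m']) = anc' @ [root t]" using \<phi>(1,4) Hang.prems(7) by auto
    then obtain \<psi> where \<psi>: "\<forall>x\<in>set (anc @ [root m']). \<psi> x = \<phi> x" "inj_on \<psi> (verts n)"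
      "\<psi> ` verts n \<subseteq> verts c" "\<psi> (root n) = root c"
      "\<forall>e\<in>edges (anc @ [root m']) n. \<psi> ` e \<in> edges (anc' @ [root t]) c"
      using Hang.IH(2)[of n "k - 1" "anc @ [root m']" "anc' @ [root t]" \<phi>] Hang.prems m dj by auto
    define \<theta> where "\<theta> x = (if x \<in> verts n then \<psi> x else \<phi> x)" for x
    have \<theta>_old: "\<theta> x = \<phi> x" if "x \<in> verts m' \<union> set anc" for x
      using that Hang.prems(4,6) m(1) by (auto simp: \<theta>_def)
    have \<theta>_new: "\<theta> x = \<psi> x" if "x \<in> verts n \<union> set (anc @ [root m'])" for x
      using that \<psi>(1) by (auto simp: \<theta>_def)
    have "inj_on \<theta> (verts m' \<union> verts n)"
    proof -
      have "inj_on \<theta> (verts m')" "inj_on \<theta> (verts n)"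
        using \<phi>(2) \<psi>(2) \<theta>_old \<theta>_new by (simp_all cong: inj_on_cong)
      moreover have "\<theta> ` verts m' \<subseteq> verts t" "\<theta> ` verts n \<subseteq> verts c"
        using \<phi>(3) \<psi>(3) \<theta>_old \<theta>_new by auto
      ultimately show ?thesis using Hang.prems(5) by (auto simp: inj_on_Un)
    qed
    moreover have "\<theta> ` e \<in> edges anc' t" if "e \<in> edges anc m'" for e
    proof -
      have "e \<subseteq> verts m' \<union> set anc"
        using edges_subset[OF that, of k] Hang.prems(2) m(1) by simp
      then have "\<theta> ` e = \<phi> ` e" using \<theta>_old by (intro image_cong) auto
      then show ?thesis using \<phi>(5) that by simp
    qed
    moreover have "\<theta> ` e \<in> edges (anc' @ [root t]) c" if "e \<in> edges (anc @ [root m']) n" for e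
    proof -
      have "bounded_tree (k - 1) (length (anc @ [root m'])) n" using Hang.prems(2) m(1) by simp
      then have "e \<subseteq> verts n \<union> set (anc @ [root m'])"
        by (rule edges_subset[OF that])
      then have "\<theta> ` e = \<psi> ` e" using \<theta>_new by (intro image_cong) auto
      then show ?thesis using \<psi>(5) that by simp
    qed
    moreover have "\<theta> ` (verts m' \<union> verts n) \<subseteq> verts t \<union> verts c"
      using \<phi>(3) \<psi>(3) \<theta>_old \<theta>_new by auto
    ultimately show ?thesis
      using \<phi>(1,4) \<theta>_old[OF UnI1, of "root m'"] \<theta>_old m(1) by (intro exI[of _ \<theta>]) auto
  qed
qed

section \<open>Parameters of subgraphs\<close>

lemma before_simps [simp]:
  "\<not> before [] x y"
  "before (a # xs) x y \<longleftrightarrow> a = x \<and> y \<in> set xs \<or> before xs x y"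
proof -
  show "\<not> before [] x y" by (simp add: before_def)
  show "before (a # xs) x y \<longleftrightarrow> a = x \<and> y \<in> set xs \<or> before xs x y"
  proof
    assume "before (a # xs) x y"
    then obtain i j where ij: "i < j" "j < Suc (length xs)" "(a # xs) ! i = x" "(a # xs) ! j = y"
      by (auto simp: before_def)
    then obtain j' where j: "j = Suc j'" by (cases j) auto
    show "a = x \<and> y \<in> set xs \<or> before xs x y"
    proof (cases i)
      case 0
      then show ?thesis using ij j by auto
    next
      case (Suc i')
      then show ?thesis using ij j by (auto simp: before_def)
    qed
  next
    assume "a = x \<and> y \<in> set xs \<or> before xs x y"
    then show "before (a # xs) x y"
    proof
      assume "a = x \<and> y \<in> set xs"
      then obtain j where "a = x" "j < length xs" "xs ! j = y" by (auto simp: in_set_conv_nth)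
      then show ?thesis unfolding before_def by (intro exI[of _ 0] exI[of _ "Suc j"]) simp
    next
      assume "before xs x y"
      then obtain i j where "i < j" "j < length xs" "xs ! i = x" "xs ! j = y"
        by (auto simp: before_def)
      then show ?thesis unfolding before_def by (intro exI[of _ "Suc i"] exI[of _ "Suc j"]) simp
    qed
  qed
qed

lemma before_append [simp]:
  "before (xs @ ys) x y \<longleftrightarrow> before xs x y \<or> before ys x y \<or> x \<in> set xs \<and> y \<in> set ys"
  by (induction xs) auto

lemma before_in_set: "before xs x y \<Longrightarrow> x \<in> set xs \<and> y \<in> set xs"
  by (induction xs) auto

lemma before_map_filter:
  "before (map f (filter P xs)) x y \<Longrightarrow> \<exists>x' y'. before xs x' y' \<and> P x' \<and> P y' \<and> f x' = x \<and> f y' = y"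
  by (induction xs) (auto split: if_splits)

text \<open>The image need not be an induced subgraph: an embedding of terms may omit
  edges.\<close>

definition graph_embedding ::
  "('a \<Rightarrow> 'b) \<Rightarrow> 'a set \<Rightarrow> 'a set set \<Rightarrow> 'b set \<Rightarrow> 'b set set \<Rightarrow> bool" where
  "graph_embedding \<phi> V E V' E' \<longleftrightarrow> inj_on \<phi> V \<and> \<phi> ` V \<subseteq> V' \<and> (\<forall>e\<in>E. \<phi> ` e \<in> E')"

lemma ex_track_layout:
  assumes "simple_graph V E"
  shows "\<exists>k T. track_layout V E T \<and> length T = k"
proof -
  obtain xs where xs: "set xs = V" "distinct xs"
    using assms finite_distinct_list[of V] by (auto simp: simple_graph_def)
  have "concat (map (\<lambda>v. [v]) xs) = xs" by (induction xs) auto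
  then have "track_layout V E (map (\<lambda>v. [v]) xs)"
    using xs assms by (auto simp: track_layout_def simple_graph_def)
  then show ?thesis by blast
qed

text \<open>A layout is restricted to the image of the embedding and then renamed.\<close>

lemma track_layout_pullback:
  assumes T: "track_layout V' E' T" and \<phi>: "graph_embedding \<phi> V E V' E'"
  shows "track_layout V E (map (\<lambda>s. map (inv_into V \<phi>) (filter (\<lambda>x. x \<in> \<phi> ` V) s)) T)"
    (is "track_layout V E ?T")
proof -
  let ?\<psi> = "inv_into V \<phi>" and ?P = "\<lambda>x. x \<in> \<phi> ` V"
  have inj: "inj_on \<phi> V" and into: "\<phi> ` V \<subseteq> V'" and edge: "\<And>e. e \<in> E \<Longrightarrow> \<phi> ` e \<in> E'"
    using \<phi> by (auto simp: graph_embedding_def)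
  have \<psi>: "\<phi> (?\<psi> x) = x" if "?P x" for x using that by (rule f_inv_into_f)
  have edge': "{x, y} \<in> E'" if "?P x" "?P y" "{?\<psi> x, ?\<psi> y} \<in> E" for x y
    using edge[OF that(3)] that(1,2) by (simp add: \<psi>)
  have concat: "concat ?T = map ?\<psi> (filter ?P (concat T))"
    by (induction T) auto
  have "distinct (concat ?T)"
    using T unfolding concat
    by (auto simp: track_layout_def distinct_map intro: inj_on_subset[OF inj_on_inv_into])
  moreover have "set (concat ?T) = V"
  proof -
    have "set (concat ?T) = ?\<psi> ` (\<phi> ` V \<inter> V')"
      using T unfolding concat by (auto simp: track_layout_def)
    also have "\<dots> = ?\<psi> ` \<phi> ` V" using into by (simp add: Int_absorb2)
    finally show ?thesis using inj by simp
  qed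
  moreover have "{u, v} \<notin> E" if s: "s \<in> set ?T" and uv: "u \<in> set s" "v \<in> set s" for s u v
  proof -
    obtain s' where s': "s' \<in> set T" "s = map ?\<psi> (filter ?P s')" using s by auto
    then obtain x y where "x \<in> set s'" "y \<in> set s'" "?P x" "?P y" "u = ?\<psi> x" "v = ?\<psi> y"
      using uv by auto
    then show ?thesis using edge'[of x y] T s'(1) unfolding track_layout_def by blast
  qed
  moreover have False
    if s: "s \<in> set ?T" "t \<in> set ?T" and e: "{u, v} \<in> E" "{u', v'} \<in> E"
      and b: "before s u u'" "before t v' v"
    for s t u u' v v'
  proof -
    obtain s' t' where st: "s' \<in> set T" "s = map ?\<psi> (filter ?P s')"
      "t' \<in> set T" "t = map ?\<psi> (filter ?P t')"
      using s by auto
    obtain x x' where x: "before s' x x'" "?P x" "?P x'" "?\<psi> x = u" "?\<psi> x' = u'"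
      using before_map_filter[OF b(1)[unfolded st(2)]] by blast
    obtain y y' where y: "before t' y' y" "?P y" "?P y'" "?\<psi> y = v" "?\<psi> y' = v'"
      using before_map_filter[OF b(2)[unfolded st(4)]] by blast
    have "{x, y} \<in> E'" "{x', y'} \<in> E'"
      using edge'[of x y] edge'[of x' y'] x y e by simp_all
    then show False using T st(1,3) x(1) y(1) unfolding track_layout_def by blast
  qed
  ultimately show ?thesis unfolding track_layout_def by blast
qed

lemma track_number_mono:
  assumes "graph_embedding \<phi> V E V' E'" "simple_graph V' E'"
  shows "track_number V E \<le> track_number V' E'"
proof -
  obtain T where T: "track_layout V' E' T" "length T = track_number V' E'"
    using LeastI_ex[OF ex_track_layout[OF assms(2)]] unfolding track_number_def by blast
  show ?thesis
    unfolding track_number_def[of V E]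
    by (rule Least_le) (use track_layout_pullback[OF T(1) assms(1)] T(2) in force)
qed

lemma ex_layered_path_decomposition:
  assumes "simple_graph V E"
  shows "\<exists>k B L. path_decomposition V E B \<and> layering V E L \<and>
     (\<forall>X\<in>set B. \<forall>Y\<in>set L. card (X \<inter> Y) \<le> k)"
proof -
  have "path_decomposition V E [V]" "layering V E [V]"
    using assms by (fastforce simp: path_decomposition_def layering_def simple_graph_def)+
  then show ?thesis by fastforce
qed

lemma layered_pathwidth_mono:
  assumes \<phi>: "graph_embedding \<phi> V E V' E'" and V: "simple_graph V E" and V': "simple_graph V' E'"
  shows "layered_pathwidth V E \<le> layered_pathwidth V' E'"
proof -
  define k where "k = layered_pathwidth V' E'"
  obtain B L where B: "path_decomposition V' E' B" and L: "layering V' E' L"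
    and k: "\<forall>X\<in>set B. \<forall>Y\<in>set L. card (X \<inter> Y) \<le> k"
    using LeastI_ex[OF ex_layered_path_decomposition[OF V']]
    unfolding k_def layered_pathwidth_def by blast
  have inj: "inj_on \<phi> V" and into: "\<phi> ` V \<subseteq> V'" and edge: "\<And>e. e \<in> E \<Longrightarrow> \<phi> ` e \<in> E'"
    using \<phi> by (auto simp: graph_embedding_def)
  have E: "e \<subseteq> V" if "e \<in> E" for e using V that by (auto simp: simple_graph_def)
  define pb where "pb X = {v \<in> V. \<phi> v \<in> X}" for X
  have "path_decomposition V E (map pb B)"
    unfolding path_decomposition_def
  proof (intro conjI ballI)
    show "X \<subseteq> V" if "X \<in> set (map pb B)" for X using that by (auto simp: pb_def)
    show "\<exists>a b. a \<le> b \<and> {i. i < length (map pb B) \<and> v \<in> map pb B ! i} = {a..b}" if "v \<in> V" for v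
    proof -
      have "{i. i < length (map pb B) \<and> v \<in> map pb B ! i} = {i. i < length B \<and> \<phi> v \<in> B ! i}"
        using that by (auto simp: pb_def)
      then show ?thesis using B into that unfolding path_decomposition_def by auto
    qed
    show "\<exists>X\<in>set (map pb B). e \<subseteq> X" if e: "e \<in> E" for e
    proof -
      obtain X where "X \<in> set B" "\<phi> ` e \<subseteq> X"
        using B edge[OF e] unfolding path_decomposition_def by metis
      then show ?thesis using E[OF e] by (auto simp: pb_def)
    qed
  qed
  moreover have "layering V E (map pb L)"
    unfolding layering_def
  proof (intro conjI allI impI)
    have "(\<Union>X\<in>set L. pb X) = pb (\<Union> (set L))" by (auto simp: pb_def)
    then show "\<Union> (set (map pb L)) = V" using L into by (auto simp: layering_def pb_def)
    show "map pb L ! i \<inter> map pb L ! j = {}" if "i < j \<and> j < length (map pb L)" for i j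
    proof -
      have "L ! i \<inter> L ! j = {}" using L that by (auto simp: layering_def)
      then show ?thesis using that by (auto simp: pb_def)
    qed
    show "\<exists>i j. i < length (map pb L) \<and> j < length (map pb L) \<and> u \<in> map pb L ! i \<and>
        v \<in> map pb L ! j \<and> i \<le> Suc j \<and> j \<le> Suc i" if "{u, v} \<in> E" for u v
    proof -
      have "{\<phi> u, \<phi> v} \<in> E'" using edge[OF that] by simp
      then obtain i j where "i < length L" "j < length L" "\<phi> u \<in> L ! i" "\<phi> v \<in> L ! j"
        "i \<le> Suc j" "j \<le> Suc i" using L unfolding layering_def by blast
      then show ?thesis using E[OF that] by (intro exI[of _ i] exI[of _ j]) (auto simp: pb_def)
    qed
  qed
  moreover have "\<forall>X\<in>set (map pb B). \<forall>Y\<in>set (map pb L). card (X \<inter> Y) \<le> k"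
  proof -
    have "card (pb X \<inter> pb Y) \<le> k" if "X \<in> set B" "Y \<in> set L" for X Y
    proof -
      have "X \<subseteq> V'" using B that by (auto simp: path_decomposition_def)
      then have "finite (X \<inter> Y)" using V' finite_subset by (auto simp: simple_graph_def)
      moreover have "inj_on \<phi> (pb X \<inter> pb Y)"
        by (rule inj_on_subset[OF inj]) (auto simp: pb_def)
      ultimately have "card (pb X \<inter> pb Y) \<le> card (X \<inter> Y)"
        by (rule card_inj_on_le[rotated 2]) (auto simp: pb_def)
      then show ?thesis using k that by fastforce
    qed
    then show ?thesis by auto
  qed
  ultimately show ?thesis
    unfolding k_def[symmetric] unfolding layered_pathwidth_def by (intro Least_le) blast
qed

section \<open>Parameters of graphs of bounded height\<close>

text \<open>Every level, ordered by time of discovery, will be a track.\<close>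

primrec level :: "'v tree \<Rightarrow> nat \<Rightarrow> 'v list" where
  "level (Node v) l = (if l = 0 then [v] else [])"
| "level (Link t j) l = level t l"
| "level (Hang t c) l = level t l @ (case l of 0 \<Rightarrow> [] | Suc l' \<Rightarrow> level c l')"

lemma level_0 [simp]: "level t 0 = [root t]"
  by (induction t) auto

lemma level_subset: "set (level t l) \<subseteq> verts t"
  by (induction t arbitrary: l) (auto split: nat.splits)

lemma verts_level:
  assumes "bounded_tree k i t" shows "verts t = (\<Union>l\<le>k. set (level t l))"
  using assms
proof (induction t arbitrary: k i)
  case (Hang t c)
  then obtain k' where k: "k = Suc k'" by (cases k) auto
  have "(\<Union>l\<le>Suc k'. set (level (Hang t c) l)) =
      (\<Union>l\<le>Suc k'. set (level t l)) \<union> (\<Union>l\<le>k'. set (level c l))"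
    by (simp add: atMost_Suc_eq_insert_0 UN_Un_distrib Un_ac)
  also have "\<dots> = verts t \<union> verts c"
    using Hang.IH(1)[of k i] Hang.IH(2)[of k' "Suc i"] Hang.prems by (simp add: k)
  finally show ?case by (simp add: k)
qed (auto)

lemma distinct_level: "distinct_tree t \<Longrightarrow> distinct (level t l)"
proof (induction t arbitrary: l)
  case (Hang t c)
  then show ?case using level_subset[of t] level_subset[of c]
    by (fastforce split: nat.splits)
qed auto

lemma level_disjoint: "distinct_tree t \<Longrightarrow> v \<in> set (level t l) \<Longrightarrow> v \<in> set (level t l') \<Longrightarrow> l = l'"
proof (induction t arbitrary: l l')
  case (Hang t c)
  have dj: "verts t \<inter> verts c = {}" using Hang.prems by simp
  show ?case
  proof (cases "v \<in> verts t")
    case True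
    then have "v \<in> set (level t l)" "v \<in> set (level t l')"
      using Hang.prems dj level_subset[of c] by (auto split: nat.splits)
    then show ?thesis using Hang by simp
  next
    case False
    then obtain m m' where "l = Suc m" "l' = Suc m'" "v \<in> set (level c m)" "v \<in> set (level c m')"
      using Hang.prems level_subset[of t] by (auto split: nat.splits)
    then show ?thesis using Hang by simp
  qed
qed (auto split: if_splits)

lemma edges_levels:
  assumes "{u, v} \<in> edges anc t" "bounded_tree k (length anc) t" "distinct_tree t"
    "set anc \<inter> verts t = {}" "u \<in> set (level t l)" "v \<in> set (level t l)"
  shows False
  using assms
proof (induction t arbitrary: anc k l)
  case (Link t j)
  have "anc ! j \<notin> verts t" using Link.prems(2,4) by (auto simp: disjoint_iff)
  then have "{u, v} \<noteq> {root t, anc ! j}"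
    using Link.prems(5,6) level_subset[of t l] by (auto simp: doubleton_eq_iff)
  then show ?case using Link by auto
next
  case (Hang t c)
  have root: "root t \<notin> verts c" using Hang.prems(3) by (auto simp: disjoint_iff)
  show ?case
  proof (cases "{u, v} \<in> edges anc t")
    case True
    have "{u, v} \<subseteq> verts t \<union> set anc"
      using edges_subset[OF True, of k] Hang.prems(2) by simp
    then have "u \<in> set (level t l)" "v \<in> set (level t l)"
      using Hang.prems level_subset[of c] by (auto simp: disjoint_iff split: nat.splits)
    then show ?thesis using Hang.IH(1)[OF True, of k l] Hang.prems by (auto simp: disjoint_iff)
  next
    case False
    then have e: "{u, v} \<in> edges (anc @ [root t]) c" using Hang.prems(1) by simp
    have b: "bounded_tree (k - 1) (length (anc @ [root t])) c" using Hang.prems(2) by simp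
    have dj: "set (anc @ [root t]) \<inter> verts c = {}" using Hang.prems(4) root by auto
    have sub: "{u, v} \<subseteq> verts c \<union> set (anc @ [root t])" by (rule edges_subset[OF e b])
    obtain w where w: "w \<in> {u, v}" "w \<in> verts c"
      using edges_cases[OF e b] by blast
    then have "w \<notin> verts t" using Hang.prems(3) by auto
    then obtain m where m: "l = Suc m"
      using w Hang.prems(5,6) level_subset[of t] by (cases l) auto
    have "x \<in> set (level c m)" if "x \<in> {u, v}" for x
    proof (rule ccontr)
      assume "\<not> ?thesis"
      then have x: "x \<in> set (level t l)" using that Hang.prems(5,6) m by auto
      then have "x \<in> verts t" using level_subset by fast
      then have "x = root t"
        using sub that Hang.prems(3,4) by auto
      then have "x \<in> set (level t 0)" by simp
      then show False using level_disjoint[of t x l 0] x m Hang.prems(3) by simp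
    qed
    then show ?thesis using Hang.IH(2)[OF e b _ dj] Hang.prems(3) by auto
  qed
qed simp

text \<open>An edge below the last child either stays among the descendants of this child or
  goes to one of its ancestors. The root is alone on its level and thus takes part in no
  crossing. Hence both edges lie below the last child or both in the rest, since the vertices of
  the child come after all others on each level.\<close>

lemma level_no_crossing:
  assumes "{u, v} \<in> edges anc t" "{u', v'} \<in> edges anc t" "bounded_tree k (length anc) t"
    "distinct_tree t" "set anc \<inter> verts t = {}"
    "before (level t l) u u'" "before (level t m) v' v"
  shows False
  using assms
proof (induction t arbitrary: anc k l m)
  case (Link t j)
  have "anc ! j \<notin> verts t" using Link.prems by (auto simp: disjoint_iff)
  moreover have "u \<in> verts t" "u' \<in> verts t" "v \<in> verts t" "v' \<in> verts t"
    using Link.prems(6,7) before_in_set level_subset by (fastforce dest: before_in_set)+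
  ultimately have "{u, v} \<noteq> {root t, anc ! j}" "{u', v'} \<noteq> {root t, anc ! j}"
    by (auto simp: doubleton_eq_iff)
  then show ?case using Link by auto
next
  case (Hang t c)
  let ?t = "Hang t c"
  have bt: "bounded_tree k (length anc) t"
    and bc: "bounded_tree (k - 1) (length (anc @ [root t])) c" using Hang.prems(3) by simp_all
  have root: "root t \<notin> verts c" using Hang.prems(4) by (auto simp: disjoint_iff)
  have dj: "set (anc @ [root t]) \<inter> verts c = {}" using Hang.prems(5) root by auto
  have in_t: "u \<in> verts ?t" "u' \<in> verts ?t" "v \<in> verts ?t" "v' \<in> verts ?t"
    using Hang.prems(6,7) level_subset[of ?t l] level_subset[of ?t m]
    by (blast dest: before_in_set)+
  \<comment> \<open>the root is alone on its level, so it is neither before nor after another vertex\<close>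
  have not_root: "x \<noteq> root t \<and> y \<noteq> root t" if "before (level ?t l') x y" for l' x y
  proof (cases l')
    case 0
    then show ?thesis using that by simp
  next
    case (Suc n)
    have "root t \<notin> set (level ?t l')"
      using level_disjoint[of ?t "root t" l' 0] Hang.prems(4) Suc by auto
    then show ?thesis using before_in_set[OF that] by auto
  qed
  have edge: "x \<in> verts t \<and> y \<in> verts t \<and> {x, y} \<in> edges anc t \<or>
      x \<in> verts c \<and> y \<in> verts c \<and> {x, y} \<in> edges (anc @ [root t]) c"
    if "{x, y} \<in> edges anc ?t" "x \<in> verts ?t" "y \<in> verts ?t" "x \<noteq> root t" "y \<noteq> root t" for x y
  proof (cases "{x, y} \<in> edges anc t")
    case True
    then have "{x, y} \<subseteq> verts t \<union> set anc" by (rule edges_subset[OF _ bt])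
    then show ?thesis using that(2,3) Hang.prems(5) True by auto
  next
    case False
    then have e: "{x, y} \<in> edges (anc @ [root t]) c" using that(1) by simp
    then have "{x, y} \<subseteq> verts c \<union> set (anc @ [root t])" by (rule edges_subset[OF _ bc])
    then show ?thesis using that Hang.prems(5) e by auto
  qed
  have before: "(x \<in> verts t \<and> before (level t l') x y) \<or> (x \<in> verts t \<and> y \<in> verts c) \<or>
      (\<exists>n. l' = Suc n \<and> x \<in> verts c \<and> before (level c n) x y)"
    if "before (level ?t l') x y" for l' x y
    using that level_subset[of t l'] level_subset[of c "l' - 1"]
    by (auto split: nat.splits dest: before_in_set)
  have dtc: "verts t \<inter> verts c = {}" "distinct_tree t" "distinct_tree c"
    using Hang.prems(4) by simp_all
  have bt': "y \<in> verts t" if "before (level t l') x y" for l' x y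
    using that level_subset[of t l'] by (blast dest: before_in_set)
  have bc': "y \<in> verts c" if "before (level c l') x y" for l' x y
    using that level_subset[of c l'] by (blast dest: before_in_set)
  have nr: "u \<noteq> root t" "u' \<noteq> root t" "v \<noteq> root t" "v' \<noteq> root t"
    using not_root Hang.prems(6,7) by blast+
  note e1 = edge[OF Hang.prems(1) in_t(1,3) nr(1,3)]
  note e2 = edge[OF Hang.prems(2) in_t(2,4) nr(2,4)]
  show False
  proof (cases "u \<in> verts t")
    case True
    then have v: "v \<in> verts t" "{u, v} \<in> edges anc t" using e1 dtc by auto
    have m: "before (level t m) v' v" "v' \<in> verts t"
      using before[OF Hang.prems(7)] v dtc bc' by auto
    then have "u' \<in> verts t" "{u', v'} \<in> edges anc t" using e2 dtc by auto
    moreover have "before (level t l) u u'"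
      using before[OF Hang.prems(6)] True calculation dtc by auto
    ultimately show False
      using Hang.IH(1)[OF v(2) _ bt dtc(2) _ _ m(1)] Hang.prems(5) by auto
  next
    case False
    then obtain n where n: "before (level c n) u u'" "u \<in> verts c"
      using before[OF Hang.prems(6)] by auto
    then have v: "v \<in> verts c" "{u, v} \<in> edges (anc @ [root t]) c" using e1 False by auto
    have u': "u' \<in> verts c" using bc' n(1) by blast
    then have v': "v' \<in> verts c" "{u', v'} \<in> edges (anc @ [root t]) c" using e2 dtc by auto
    then obtain n' where "before (level c n') v' v"
      using before[OF Hang.prems(7)] dtc by auto
    then show False
      using Hang.IH(2)[OF v(2) v'(2) bc dtc(3) dj n(1)] by blast
  qed
qed auto

lemma tree_simple_graph:
  assumes "bounded_tree k 0 t" "distinct_tree t"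
  shows "simple_graph (verts t) (edges [] t)"
  using edges_subset[of _ "[]" t k] edges_simple[of _ "[]" t k] assms
  by (auto simp: simple_graph_def)

lemma distinct_concat_map_upt:
  assumes "\<And>l. distinct (g l)" "\<And>v l l'. v \<in> set (g l) \<Longrightarrow> v \<in> set (g l') \<Longrightarrow> l = l'"
  shows "distinct (concat (map g [0..<n]))"
proof (induction n)
  case (Suc n)
  have "set (concat (map g [0..<n])) \<inter> set (g n) = {}" by (auto dest: assms(2))
  then show ?case using Suc assms(1) by simp
qed simp

lemma track_number_tree:
  assumes "bounded_tree k 0 t" "distinct_tree t"
  shows "track_number (verts t) (edges [] t) \<le> Suc k"
proof -
  let ?T = "map (level t) [0..<Suc k]"
  have "distinct (concat ?T)"
    by (rule distinct_concat_map_upt[OF distinct_level[OF assms(2)] level_disjoint[OF assms(2)]])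
  moreover have "set (concat ?T) = verts t"
    unfolding verts_level[OF assms(1)] by (simp add: lessThan_Suc_atMost atLeast0LessThan del: upt_Suc)
  moreover have "{u, v} \<notin> edges [] t" if "u \<in> set (level t l)" "v \<in> set (level t l)" for u v l
    using edges_levels[of u v "[]" t k l] that assms by auto
  moreover have False if "{u, v} \<in> edges [] t" "{u', v'} \<in> edges [] t"
    "before (level t l) u u'" "before (level t m) v' v" for u v u' v' l m
    using level_no_crossing[of u v "[]" t u' v' k l m] that assms by auto
  ultimately have "track_layout (verts t) (edges [] t) ?T"
    unfolding track_layout_def set_map by blast
  moreover have "length ?T = Suc k" by simp
  ultimately show ?thesis
    unfolding track_number_def by (intro Least_le) blast
qed

text \<open>The bags are the root-to-vertex paths in order of discovery.\<close>

primrec bags :: "'v tree \<Rightarrow> 'v set list" where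
  "bags (Node v) = [{v}]"
| "bags (Link t j) = bags t"
| "bags (Hang t c) = bags t @ map (insert (root t)) (bags c)"

lemma bags_subset: "X \<in> set (bags t) \<Longrightarrow> X \<subseteq> verts t"
  by (induction t arbitrary: X) auto

lemma root_in_bags: "X \<in> set (bags t) \<Longrightarrow> root t \<in> X"
  by (induction t arbitrary: X) auto

lemma bags_nonempty [simp]: "bags t \<noteq> []"
  by (induction t) auto

lemma card_bags: "X \<in> set (bags t) \<Longrightarrow> bounded_tree k i t \<Longrightarrow> card X \<le> Suc k"
proof (induction t arbitrary: X k i)
  case (Hang t c)
  show ?case
  proof (cases "X \<in> set (bags t)")
    case True
    then show ?thesis using Hang by auto
  next
    case False
    then obtain Y where Y: "Y \<in> set (bags c)" "X = insert (root t) Y" using Hang.prems(1) by auto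
    then have "card Y \<le> k" using Hang.IH(2)[of Y "k - 1" "Suc i"] Hang.prems(2) by simp
    then show ?thesis using Y(2) card_insert_le_m1[of "Suc k" Y "root t"] by simp
  qed
qed auto

lemma edges_in_bags:
  assumes "e \<in> edges anc t" "bounded_tree k (length anc) t"
  shows "\<exists>X\<in>set (bags t). e \<subseteq> X \<union> set anc"
  using assms
proof (induction t arbitrary: anc k)
  case (Link t j)
  have "root t \<in> hd (bags t)" "hd (bags t) \<in> set (bags t)" by (simp_all add: root_in_bags)
  then have "\<exists>X\<in>set (bags t). {root t, anc ! j} \<subseteq> X \<union> set anc"
    using Link.prems(2) by (intro bexI[of _ "hd (bags t)"]) simp_all
  moreover have "e = {root t, anc ! j} \<or> e \<in> edges anc t" "bounded_tree k (length anc) t"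
    using Link.prems by simp_all
  ultimately show ?case using Link.IH[of anc k] by auto
next
  case (Hang t c)
  show ?case
  proof (cases "e \<in> edges anc t")
    case True
    then show ?thesis using Hang.IH(1)[of anc k] Hang.prems by auto
  next
    case False
    then obtain X where "X \<in> set (bags c)" "e \<subseteq> X \<union> set (anc @ [root t])"
      using Hang.IH(2)[of "anc @ [root t]" "k - 1"] Hang.prems by auto
    then show ?thesis by (intro bexI[of _ "insert (root t) X"]) auto
  qed
qed simp

lemma bags_interval:
  assumes "v \<in> verts t" "distinct_tree t"
  shows "\<exists>a b. a \<le> b \<and> {i. i < length (bags t) \<and> v \<in> bags t ! i} = {a..b}"
  using assms
proof (induction t)
  case (Node u)
  then show ?case by (intro exI[of _ 0]) auto
next
  case (Hang t c)
  let ?m = "length (bags t)" and ?n = "length (bags c)" and ?B = "bags (Hang t c)"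
  have dj: "verts t \<inter> verts c = {}" using Hang.prems(2) by simp
  have left: "?B ! i = bags t ! i" if "i < ?m" for i using that by (simp add: nth_append)
  have right: "?B ! i = insert (root t) (bags c ! (i - ?m))" if "?m \<le> i" "i < ?m + ?n" for i
    using that by (simp add: nth_append)
  have sub: "i < ?m \<Longrightarrow> bags t ! i \<subseteq> verts t" "i < ?n \<Longrightarrow> bags c ! i \<subseteq> verts c" for i
    by (simp_all add: bags_subset)
  consider "v = root t" | "v \<in> verts t" "v \<noteq> root t" | "v \<in> verts c" "v \<notin> verts t"
    using Hang.prems by auto
  then show ?case
  proof cases
    case 1
    have "{i. i < length ?B \<and> v \<in> ?B ! i} = {0..?m + ?n - 1}"
    proof -
      have "v \<in> ?B ! i" if "i < ?m + ?n" for i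
        using 1 that root_in_bags[OF nth_mem, of i "Hang t c"] by simp
      moreover obtain m where "?m = Suc m" by (cases "bags t") auto
      ultimately show ?thesis by auto
    qed
    then show ?thesis by blast
  next
    case 2
    then have "v \<in> ?B ! i \<longleftrightarrow> i < ?m \<and> v \<in> bags t ! i" if "i < ?m + ?n" for i
    proof (cases "i < ?m")
      case False
      then have "bags c ! (i - ?m) \<subseteq> verts c" using sub(2)[of "i - ?m"] that by auto
      then show ?thesis using False right[of i] that 2 dj by auto
    qed (use left in auto)
    then have "{i. i < length ?B \<and> v \<in> ?B ! i} = {i. i < ?m \<and> v \<in> bags t ! i}" by auto
    then show ?thesis using Hang.IH(1) 2 Hang.prems by simp
  next
    case 3
    then have "v \<noteq> root t" by auto
    with 3 have iff: "v \<in> ?B ! i \<longleftrightarrow> ?m \<le> i \<and> v \<in> bags c ! (i - ?m)" if "i < ?m + ?n" for i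
      using that left[of i] right[of i] sub(1)[of i] by (cases "i < ?m") auto
    obtain a b where ab: "a \<le> b" "{i. i < ?n \<and> v \<in> bags c ! i} = {a..b}"
      using Hang.IH(2) 3 Hang.prems by auto
    have "{i. i < length ?B \<and> v \<in> ?B ! i} = (+) ?m ` {i. i < ?n \<and> v \<in> bags c ! i}"
    proof (intro equalityI subsetI)
      fix i assume "i \<in> {i. i < length ?B \<and> v \<in> ?B ! i}"
      then have i: "i < ?m + ?n" "v \<in> ?B ! i" by auto
      then have "?m \<le> i" "v \<in> bags c ! (i - ?m)" using iff by auto
      then show "i \<in> (+) ?m ` {i. i < ?n \<and> v \<in> bags c ! i}"
        using i(1) by (intro image_eqI[of _ _ "i - ?m"]) auto
    qed (use iff in auto)
    also have "\<dots> = {?m + a..?m + b}" by (simp add: ab(2))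
    finally show ?thesis using ab(1) by (intro exI[of _ "?m + a"] exI[of _ "?m + b"]) simp
  qed
qed auto

text \<open>A single layer suffices, so that the bound is the one for the pathwidth.\<close>

lemma layered_pathwidth_tree:
  assumes "bounded_tree k 0 t" "distinct_tree t"
  shows "layered_pathwidth (verts t) (edges [] t) \<le> Suc k"
proof -
  have "path_decomposition (verts t) (edges [] t) (bags t)"
    using edges_in_bags[of _ "[]" t k] bags_interval[of _ t] bags_subset[of _ t] assms
    by (simp add: path_decomposition_def)
  moreover have "layering (verts t) (edges [] t) [verts t]"
    using tree_simple_graph[OF assms] by (fastforce simp: layering_def simple_graph_def)
  moreover have "\<forall>X\<in>set (bags t). \<forall>Y\<in>set [verts t]. card (X \<inter> Y) \<le> Suc k"
    using card_bags[OF _ assms(1)] bags_subset[of _ t] by (simp add: Int_absorb2)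
  ultimately show ?thesis
    unfolding layered_pathwidth_def by (intro Least_le) blast
qed

section \<open>Paths in graphs of bounded tree-depth\<close>

text \<open>This makes the least height in the definition of the tree-depth an attained
  one.\<close>

lemma ex_linear_forest:
  assumes "simple_graph V E"
  shows "\<exists>F. rooted_forest V F \<and> (\<forall>u v. {u, v} \<in> E \<longrightarrow> (u, v) \<in> F\<^sup>+ \<or> (v, u) \<in> F\<^sup>+)"
proof -
  obtain xs where xs: "set xs = V" "distinct xs"
    using assms finite_distinct_list[of V] by (auto simp: simple_graph_def)
  define F where "F = {(xs ! Suc i, xs ! i) | i. Suc i < length xs}"
  have "single_valued F"
    using xs(2) by (auto simp: F_def single_valued_def nth_eq_iff_index_eq)
  moreover have "F \<subseteq> V \<times> V"
    using xs(1) by (auto simp: F_def)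
  moreover have "acyclic F"
  proof -
    have "F\<inverse> \<subseteq> measure (inv_into {..<length xs} ((!) xs))"
      using xs(2) by (auto simp: F_def inv_into_f_f inj_on_nth)
    then have "wf (F\<inverse>)" by (rule wf_subset[OF wf_measure])
    then show ?thesis using wf_acyclic acyclic_converse by blast
  qed
  moreover have chain: "(xs ! j, xs ! i) \<in> F\<^sup>+" if "i < j" "j < length xs" for i j
    using that
  proof (induction j)
    case (Suc j)
    have "(xs ! Suc j, xs ! j) \<in> F" using Suc.prems by (auto simp: F_def)
    then show ?case
    proof (cases "i = j")
      case False
      then have "(xs ! j, xs ! i) \<in> F\<^sup>+" using Suc by simp
      then show ?thesis using \<open>(xs ! Suc j, xs ! j) \<in> F\<close> by (rule trancl_into_trancl2[rotated])
    qed auto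
  qed simp
  moreover have "(u, v) \<in> F\<^sup>+ \<or> (v, u) \<in> F\<^sup>+" if "{u, v} \<in> E" for u v
  proof -
    have "u \<in> V" "v \<in> V" "u \<noteq> v" using assms that by (auto simp: simple_graph_def)
    then obtain i j where "i < length xs" "j < length xs" "xs ! i = u" "xs ! j = v" "i \<noteq> j"
      using xs(1) by (metis in_set_conv_nth)
    then show ?thesis using chain[of i j] chain[of j i] by (cases i j rule: linorder_cases) auto
  qed
  ultimately show ?thesis unfolding rooted_forest_def by blast
qed

definition root_path :: "('a \<times> 'a) set \<Rightarrow> 'a list \<Rightarrow> 'a \<Rightarrow> bool" where
  "root_path F p v \<longleftrightarrow> p \<noteq> [] \<and> successively (\<lambda>u v. (v, u) \<in> F) p \<and> hd p \<notin> Domain F \<and> last p = v"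

lemma root_path_root: "v \<notin> Domain F \<Longrightarrow> root_path F p v \<longleftrightarrow> p = [v]"
  by (cases p rule: rev_cases) (auto simp: root_path_def successively_append_iff)

lemma root_path_child:
  assumes "single_valued F" "(v, w) \<in> F"
  shows "root_path F p v \<longleftrightarrow> (\<exists>q. p = q @ [v] \<and> root_path F q w)"
proof (cases p rule: rev_cases)
  case (snoc q x)
  have "(v, x) \<in> F \<longleftrightarrow> x = w" for x using assms by (auto dest: single_valuedD)
  then show ?thesis
    using snoc assms(2) by (cases "q = []") (auto simp: root_path_def successively_append_iff)
qed (simp add: root_path_def)

lemma ex1_root_path:
  assumes "single_valued F" "acyclic F" "finite F"
  shows "\<exists>!p. root_path F p v"
proof (induction v rule: wf_induct_rule[OF finite_acyclic_wf_converse[OF assms(3,2)]])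
  case (1 v)
  show ?case
  proof (cases "v \<in> Domain F")
    case True
    then obtain w where w: "(v, w) \<in> F" by blast
    then have "\<exists>!q. root_path F q w" using 1 by blast
    then show ?thesis unfolding root_path_child[OF assms(1) w] by blast
  qed (simp add: root_path_root)
qed

lemma descending_path_distinct:
  assumes "successively (\<lambda>u v. (v, u) \<in> F) p" "acyclic F"
  shows "distinct p \<and> (\<forall>x\<in>set p. (last p, x) \<in> F\<^sup>*)"
  using assms(1)
proof (induction p rule: rev_induct)
  case (snoc v p)
  show ?case
  proof (cases "p = []")
    case False
    then have IH: "distinct p" "\<And>x. x \<in> set p \<Longrightarrow> (last p, x) \<in> F\<^sup>*" "(v, last p) \<in> F"
      using snoc by (auto simp: successively_append_iff)
    then have "(v, x) \<in> F\<^sup>+" if "x \<in> set p" for x using that by (meson rtrancl_into_trancl2)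
    then show ?thesis using IH(1) assms(2) by (auto simp: acyclic_def trancl_into_rtrancl)
  qed simp
qed simp

text \<open>The height is defined by paths that end in a leaf, so the path to \<open>v\<close>
  is first continued to a leaf.\<close>

lemma root_path_length:
  assumes F: "rooted_forest V F" and V: "finite V" and p: "root_path F p v" "v \<in> V"
  shows "length p \<le> forest_height V F"
proof -
  have FV: "F \<subseteq> V \<times> V" "acyclic F" using F by (auto simp: rooted_forest_def)
  then have fin: "finite F" using V finite_subset by blast
  have sub: "set p \<subseteq> V" if "successively (\<lambda>u v. (v, u) \<in> F) p" "p \<noteq> []" "last p \<in> V" for p
    using that
  proof (induction p rule: rev_induct)
    case (snoc x p)
    then show ?case using FV(1) by (cases "p = []") (auto simp: successively_append_iff)
  qed simp
  have "\<exists>q. root_to_leaf_path V F (p @ q)"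
    using p
  proof (induction v arbitrary: p rule: wf_induct_rule[OF finite_acyclic_wf[OF fin FV(2)]])
    case (1 v)
    show ?case
    proof (cases "v \<in> Range F")
      case True
      then obtain w where w: "(w, v) \<in> F" by blast
      then have "root_path F (p @ [w]) w"
        using 1(2) by (auto simp: root_path_def successively_append_iff)
      then obtain q where "root_to_leaf_path V F ((p @ [w]) @ q)" using 1(1)[OF w] w FV(1) by blast
      then show ?thesis by auto
    next
      case False
      then have "root_to_leaf_path V F (p @ [])"
        using 1(2,3) sub[of p] by (auto simp: root_path_def root_to_leaf_path_def)
      then show ?thesis by blast
    qed
  qed
  then obtain q where q: "root_to_leaf_path V F (p @ q)" by blast
  have "length r \<le> card V" if "root_to_leaf_path V F r" for r
  proof -
    have "distinct r" "set r \<subseteq> V"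
      using that descending_path_distinct[OF _ FV(2)] by (auto simp: root_to_leaf_path_def)
    then show ?thesis using V card_mono distinct_card by metis
  qed
  then have "{length r | r. root_to_leaf_path V F r} \<subseteq> {..card V}" by fast
  then have "finite {length r | r. root_to_leaf_path V F r}" by (rule finite_subset) simp
  moreover have "length (p @ q) \<in> {length r | r. root_to_leaf_path V F r}" using q by blast
  ultimately have "length (p @ q) \<le> forest_height V F"
    unfolding forest_height_def by (intro Max_ge) (simp_all only: finite_insert insertI2)
  then show ?thesis by simp
qed

text \<open>\<open>anc v\<close> is the path from the root to \<open>v\<close> in a forest of
  height \<open>d\<close>, and consecutive vertices of \<open>p\<close> are comparable. If all
  of \<open>p\<close> is below depth \<open>d - Suc k\<close>, then all vertices of
  \<open>p\<close> have the same ancestor at depth \<open>d - k\<close>, so at most one vertex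
  of \<open>p\<close> has exactly that depth. Removing this vertex leaves two paths of vertices
  that are deeper by one.\<close>

lemma comparable_path_length:
  fixes anc :: "'a \<Rightarrow> 'b list"
  assumes "\<And>v. v \<in> set p \<Longrightarrow> length (anc v) \<le> d" "inj_on anc (set p)"
    and "successively (\<lambda>u v. \<exists>zs. anc u = anc v @ zs \<or> anc v = anc u @ zs) p"
    and "distinct p" "\<And>v. v \<in> set p \<Longrightarrow> d < length (anc v) + k"
  shows "length p < 2 ^ k"
  using assms
proof (induction k arbitrary: p)
  case 0
  then have "v \<notin> set p" for v using "0.prems"(1,5)[of v] by fastforce
  then have "set p = {}" by (simp only: set_eq_iff empty_iff) simp
  then show ?case by simp
next
  case (Suc k)
  have take: "take (d - k) (anc x) = take (d - k) (anc y)" if "x \<in> set p" "y \<in> set p" for x y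
  proof -
    have "\<exists>t. \<forall>x\<in>set p. take (d - k) (anc x) = t"
      using Suc.prems(3,5)
    proof (induction p)
      case (Cons a p)
      then obtain t where t: "\<forall>x\<in>set p. take (d - k) (anc x) = t"
        by (auto simp: successively_Cons)
      show ?case
      proof (cases "p = []")
        case False
        then obtain zs where "anc a = anc (hd p) @ zs \<or> anc (hd p) = anc a @ zs"
          using Cons.prems(1) by (auto simp: successively_Cons)
        moreover have "d - k \<le> length (anc a)" "d - k \<le> length (anc (hd p))"
          using Cons.prems(2)[of a] Cons.prems(2)[of "hd p"] False by auto
        ultimately have "take (d - k) (anc a) = take (d - k) (anc (hd p))" by auto
        then show ?thesis using t False by auto
      qed auto
    qed simp
    then show ?thesis using that by metis
  qed
  have unique: "x = y" if "x \<in> set p" "y \<in> set p" "length (anc x) + k \<le> d" "length (anc y) + k \<le> d" for x y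
  proof -
    have "anc x = anc y" using take[OF that(1,2)] that(3,4) by simp
    then show ?thesis using Suc.prems(2) that by (auto dest: inj_onD)
  qed
  have sub: "length q < 2 ^ k" if q: "set q \<subseteq> set p" "distinct q"
    "successively (\<lambda>u v. \<exists>zs. anc u = anc v @ zs \<or> anc v = anc u @ zs) q"
    "\<And>v. v \<in> set q \<Longrightarrow> d < length (anc v) + k" for q
    by (rule Suc.IH) (use q Suc.prems(1,2) in \<open>auto intro: inj_on_subset\<close>)
  show ?case
  proof (cases "\<exists>x\<in>set p. length (anc x) + k \<le> d")
    case True
    then obtain x a b where x: "x \<in> set p" "length (anc x) + k \<le> d" and p: "p = a @ x # b"
      by (meson split_list)
    have "d < length (anc y) + k" if "y \<in> set a \<union> set b" for y
    proof (rule ccontr)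
      assume "\<not> ?thesis"
      then have "y = x" using unique[of y x] that x p by auto
      then show False using that p Suc.prems(4) by auto
    qed
    then have "length a < 2 ^ k" "length b < 2 ^ k"
      using Suc.prems(3,4) p by (auto intro!: sub simp: successively_append_iff successively_Cons)
    then show ?thesis using p by simp
  next
    case False
    then have "length p < 2 ^ k"
      using Suc.prems(3,4) by (intro sub) (auto simp: not_le)
    then show ?thesis by simp
  qed
qed

text \<open>The paths from the roots are nonempty, so comparability along \<open>p\<close> is
  exploited at \<open>d\<close> depths, and the bound doubles at each of them.\<close>

lemma tree_depth_path_length:
  assumes G: "simple_graph V E" and d: "tree_depth V E \<le> d"
    and p: "set p \<subseteq> V" "distinct p" "successively (\<lambda>u v. {u, v} \<in> E) p"
  shows "length p < 2 ^ d"
proof -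
  have "\<exists>h F. rooted_forest V F \<and> (\<forall>u v. {u, v} \<in> E \<longrightarrow> (u, v) \<in> F\<^sup>+ \<or> (v, u) \<in> F\<^sup>+) \<and>
      forest_height V F = h"
    using ex_linear_forest[OF G] by blast
  then have "\<exists>F. rooted_forest V F \<and> (\<forall>u v. {u, v} \<in> E \<longrightarrow> (u, v) \<in> F\<^sup>+ \<or> (v, u) \<in> F\<^sup>+) \<and>
      forest_height V F = tree_depth V E"
    unfolding tree_depth_def by (rule LeastI_ex)
  then obtain F where F: "rooted_forest V F"
    and E: "\<And>u v. {u, v} \<in> E \<Longrightarrow> (u, v) \<in> F\<^sup>+ \<or> (v, u) \<in> F\<^sup>+"
    and height: "forest_height V F \<le> d"
    using d by auto
  have V: "finite V" using G by (simp add: simple_graph_def)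
  have FV: "F \<subseteq> V \<times> V" "acyclic F" "single_valued F" using F by (auto simp: rooted_forest_def)
  then have "finite F" using V finite_subset by blast
  then obtain anc where anc: "\<And>v. root_path F (anc v) v"
    using ex1_root_path[OF FV(3,2)] by metis
  have anc_eq: "p = anc v" if "root_path F p v" for p v
    using that anc ex1_root_path[OF FV(3,2) \<open>finite F\<close>] by blast
  have "\<exists>zs. anc u = anc v @ zs" if "(u, v) \<in> F\<^sup>+" for u v
    using that
  proof (induction rule: converse_trancl_induct)
    case (base u)
    then show ?case using root_path_child[OF FV(3) base] anc anc_eq by metis
  next
    case (step u w)
    then show ?case using root_path_child[OF FV(3) step(1)] anc anc_eq by (metis append.assoc)
  qed
  then have "\<exists>zs. anc u = anc v @ zs \<or> anc v = anc u @ zs" if "{u, v} \<in> E" for u v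
    using E[OF that] by blast
  then have "successively (\<lambda>u v. \<exists>zs. anc u = anc v @ zs \<or> anc v = anc u @ zs) p"
    using p(3) by (auto elim: successively_mono)
  moreover have "length (anc v) \<le> d" if "v \<in> set p" for v
    using root_path_length[OF F V anc] that p(1) height by fastforce
  moreover have "d < length (anc v) + d" for v using anc[of v] by (auto simp: root_path_def)
  moreover have "inj_on anc (set p)" using anc by (metis inj_onI root_path_def)
  ultimately show ?thesis using p(2) by (intro comparable_path_length) auto
qed

text \<open>A disconnected graph has no depth-first search tree with one of its vertices as the
  root. Its search trees are hung below an artificial root, which is disregarded here.\<close>

definition verts_below :: "'v tree \<Rightarrow> 'v set" where
  "verts_below t = verts t - {root t}"

definition edges_below :: "'v tree \<Rightarrow> 'v set set" where
  "edges_below t = {e \<in> edges [] t. root t \<notin> e}"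

lemma simple_graph_below:
  assumes "bounded_tree k 0 t" "distinct_tree t"
  shows "simple_graph (verts_below t) (edges_below t)"
  using tree_simple_graph[OF assms]
  by (auto simp: simple_graph_def verts_below_def edges_below_def)

lemma embedding_below:
  assumes "bounded_tree k 0 m" "distinct_tree m" "distinct_tree t" "embeds m t" "bounded_tree k 0 t"
  shows "\<exists>\<phi>. graph_embedding \<phi> (verts_below m) (edges_below m) (verts_below t) (edges_below t)"
proof -
  obtain \<phi> where \<phi>: "inj_on \<phi> (verts m)" "\<phi> ` verts m \<subseteq> verts t" "\<phi> (root m) = root t"
    "\<forall>e\<in>edges [] m. \<phi> ` e \<in> edges [] t"
    using embedding_map[of m t k "[]" "[]"] assms by auto
  have not_root: "\<phi> x \<noteq> root t" if "x \<in> verts m" "x \<noteq> root m" for x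
    using inj_onD[OF \<phi>(1), of x "root m"] that \<phi>(3) by auto
  have "root t \<notin> \<phi> ` e" if "e \<in> edges [] m" "root m \<notin> e" for e
  proof -
    have "e \<subseteq> verts m" using edges_subset[of e "[]" m k] that assms(1) by simp
    then show ?thesis using not_root that(2) by (metis imageE subsetD)
  qed
  then have "graph_embedding \<phi> (verts_below m) (edges_below m) (verts_below t) (edges_below t)"
    unfolding graph_embedding_def verts_below_def edges_below_def
    using \<phi>(2,4) not_root inj_on_subset[OF \<phi>(1) Diff_subset] by auto
  then show ?thesis by (intro exI[of _ \<phi>])
qed

definition subgraph_monotone :: "(nat set \<Rightarrow> nat set set \<Rightarrow> nat) \<Rightarrow> bool" where
  "subgraph_monotone f \<longleftrightarrow> (\<forall>\<phi> V E V' E'. graph_embedding \<phi> V E V' E' \<longrightarrow>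
     simple_graph V E \<longrightarrow> simple_graph V' E' \<longrightarrow> f V E \<le> f V' E')"

definition bounded_by_height :: "(nat set \<Rightarrow> nat set set \<Rightarrow> nat) \<Rightarrow> bool" where
  "bounded_by_height f \<longleftrightarrow> (\<forall>k t. bounded_tree k 0 t \<longrightarrow> distinct_tree t \<longrightarrow>
     f (verts t) (edges [] t) \<le> Suc k)"

text \<open>The bound by the height applies to the graph with the artificial root, of which the
  graph without it is a subgraph.\<close>

theorem finite_state_parameter:
  assumes f: "subgraph_monotone f" "bounded_by_height f"
  obtains K :: nat and code :: "nat tree \<Rightarrow> nat" and node link hang out
  where "\<And>t. code t < K" "\<And>v. code (Node v) = node" "\<And>t j. code (Link t j) = link (code t) j"
    "\<And>t c. code (Hang t c) = hang (code t) (code c)"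
    "\<And>t. bounded_tree k 0 t \<Longrightarrow> distinct_tree t \<Longrightarrow>
      out (code t) = f (verts_below t) (edges_below t)"
proof (rule finite_state_evaluation[of "\<lambda>t. bounded_tree k 0 t \<and> distinct_tree t" k 0
      "\<lambda>t. f (verts_below t) (edges_below t)" "Suc k"])
  fix t t' :: "nat tree"
  assume t: "bounded_tree k 0 t \<and> distinct_tree t" and t': "bounded_tree k 0 t' \<and> distinct_tree t'"
    and "embeds t' t"
  then show "f (verts_below t') (edges_below t') \<le> f (verts_below t) (edges_below t)"
    using embedding_below[of k t' t] f(1) simple_graph_below
    unfolding subgraph_monotone_def by blast
next
  fix t :: "nat tree"
  assume t: "bounded_tree k 0 t \<and> distinct_tree t"
  have "graph_embedding (\<lambda>x. x) (verts_below t) (edges_below t) (verts t) (edges [] t)"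
    by (auto simp: graph_embedding_def verts_below_def edges_below_def)
  then have "f (verts_below t) (edges_below t) \<le> f (verts t) (edges [] t)"
    using t f(1) simple_graph_below tree_simple_graph unfolding subgraph_monotone_def by blast
  also have "\<dots> \<le> Suc k" using t f(2) by (simp add: bounded_by_height_def)
  finally show "f (verts_below t) (edges_below t) \<le> Suc k" .
next
  fix K :: nat and code node link hang out
  assume *: "\<And>t. code t < K" "\<And>v. code (Node v) = node" "\<And>t j. code (Link t j) = link (code t) j"
    "\<And>t c. code (Hang t c) = hang (code t) (code c)"
    "\<And>t. bounded_tree k 0 t \<and> distinct_tree t \<Longrightarrow> out (code t) = f (verts_below t) (edges_below t)"
  show thesis
    by (rule that[OF *(1-4), of out]) (simp add: *(5))
qed simp

lemma track_number_parameter: "subgraph_monotone track_number" "bounded_by_height track_number"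
  using track_number_mono track_number_tree
  by (auto simp: subgraph_monotone_def bounded_by_height_def)

lemma layered_pathwidth_parameter:
  "subgraph_monotone layered_pathwidth" "bounded_by_height layered_pathwidth"
  using layered_pathwidth_mono layered_pathwidth_tree
  by (auto simp: subgraph_monotone_def bounded_by_height_def)

section \<open>Rules for running times\<close>

definition runs :: "nat \<Rightarrow> com \<Rightarrow> memory \<Rightarrow> nat \<Rightarrow> memory \<Rightarrow> bool" where
  "runs w c s T s' \<longleftrightarrow> (\<exists>t\<le>T. exec w c s t s')"

definition store :: "memory \<Rightarrow> nat \<Rightarrow> nat \<Rightarrow> nat \<Rightarrow> memory" where
  "store s k a x = s(k := (s k)(a := x))"

lemma store_apply [simp]: "store s k a x k' a' = (if k' = k \<and> a' = a then x else s k' a')"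
  by (simp add: store_def)

lemma store_other: "k' \<noteq> k \<Longrightarrow> store s k a x k' = s k'"
  by (simp add: store_def)

lemma runs_mono: "runs w c s T s' \<Longrightarrow> T \<le> T' \<Longrightarrow> runs w c s T' s'"
  unfolding runs_def by (meson le_trans)

lemma runs_Skip: "runs w Skip s 1 s"
  unfolding runs_def using exec.Skip by blast

lemma runs_Write:
  "aval a s = x \<Longrightarrow> aval b s = y \<Longrightarrow> x \<le> w \<Longrightarrow> y \<le> w \<Longrightarrow> runs w (Write k a b) s 1 (store s k x y)"
  unfolding runs_def store_def using exec.Write by blast

lemma runs_Seq: "runs w c s T s' \<Longrightarrow> runs w d s' T' s'' \<Longrightarrow> runs w (Seq c d) s (T + T') s''"
  unfolding runs_def using exec.Seq add_mono by metis

lemma runs_Cond: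
  "(bval b s \<Longrightarrow> runs w c s T s') \<Longrightarrow> (\<not> bval b s \<Longrightarrow> runs w d s T s') \<Longrightarrow>
    runs w (Cond b c d) s (Suc T) s'"
  unfolding runs_def using exec.CondTrue exec.CondFalse Suc_le_mono by metis

lemma runs_While_False: "\<not> bval b s \<Longrightarrow> runs w (While b c) s 1 s"
  unfolding runs_def using exec.WhileFalse by blast

lemma runs_While_True:
  "bval b s \<Longrightarrow> runs w c s T s' \<Longrightarrow> runs w (While b c) s' T' s'' \<Longrightarrow>
    runs w (While b c) s (Suc (T + T')) s''"
  unfolding runs_def using exec.WhileTrue add_mono Suc_le_mono by metis

text \<open>For a loop that counts \<open>l\<close> up to \<open>m\<close>. The invariant may
  bound the time \<open>\<tau>\<close> spent so far by data that it quantifies existentially.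
  This is needed for an amortized analysis: the cost of an iteration is not bounded in terms of
  \<open>l\<close>, but it is proportional to the part of the tree that the iteration
  adds.\<close>

lemma runs_loop:
  assumes step: "\<And>l s \<tau>. l < m \<Longrightarrow> I l s \<tau> \<Longrightarrow>
      bval b s \<and> (\<exists>s' T. runs w c s T s' \<and> I (Suc l) s' (\<tau> + Suc T))"
    and stop: "\<And>s \<tau>. I m s \<tau> \<Longrightarrow> \<not> bval b s"
    and "I l s \<tau>" "l \<le> m"
  shows "\<exists>s' T \<tau>'. runs w (While b c) s T s' \<and> I m s' \<tau>' \<and> \<tau> + T \<le> Suc \<tau>'"
  using assms(4,3)
proof (induction l arbitrary: s \<tau> rule: inc_induct)
  case base
  then show ?case using stop runs_While_False by (metis Suc_eq_plus1 le_refl)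
next
  case (step l)
  then obtain s' T where s': "bval b s" "runs w c s T s'" "I (Suc l) s' (\<tau> + Suc T)"
    using assms(1) by blast
  then obtain s'' T' \<tau>' where "runs w (While b c) s' T' s''" "I m s'' \<tau>'" "\<tau> + Suc T + T' \<le> Suc \<tau>'"
    using step.IH by blast
  then show ?case using runs_While_True[OF s'(1,2)]
    by (intro exI[of _ s''] exI[of _ "Suc (T + T')"] exI[of _ \<tau>']) simp
qed

definition Eq :: "aexp \<Rightarrow> aexp \<Rightarrow> bexp" where
  "Eq a b = Conj (Neg (Less a b)) (Neg (Less b a))"

lemma bval_Eq [simp]: "bval (Eq a b) s \<longleftrightarrow> aval a s = aval b s"
  by (auto simp: Eq_def)

text \<open>A case distinction over the finitely many values below \<open>m\<close>, by which a
  finite table becomes a program.\<close>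

primrec switch :: "aexp \<Rightarrow> nat \<Rightarrow> (nat \<Rightarrow> com) \<Rightarrow> com" where
  "switch e 0 c = Skip"
| "switch e (Suc m) c = Cond (Eq e (Const m)) (c m) (switch e m c)"

lemma runs_switch:
  "aval e s = x \<Longrightarrow> x < m \<Longrightarrow> runs w (c x) s T s' \<Longrightarrow> runs w (switch e m c) s (T + m) s'"
proof (induction m)
  case (Suc m)
  have "runs w (Cond (Eq e (Const m)) (c m) (switch e m c)) s (Suc (T + m)) s'"
    by (rule runs_Cond) (use Suc in \<open>auto intro: runs_mono\<close>)
  then show ?case by simp
qed simp

section \<open>Depth-first search\<close>

text \<open>Array \<open>4\<close> marks the visited vertices. At index \<open>i\<close>, the
  arrays \<open>5\<close>, \<open>6\<close> and \<open>7\<close> hold the vertex at depth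
  \<open>i\<close> of the current search path, the position in its adjacency list, and the state
  of the automaton for the part of the search below it. The artificial root has depth
  \<open>0\<close>, and its position is the next vertex to be tried as the root of a
  component.\<close>

abbreviation cur :: "nat \<Rightarrow> aexp" where "cur i \<equiv> Read 5 (Const i)"
abbreviation ptr :: "nat \<Rightarrow> aexp" where "ptr i \<equiv> Read 6 (Const i)"
abbreviation state :: "nat \<Rightarrow> aexp" where "state i \<equiv> Read 7 (Const i)"
abbreviation advance :: "nat \<Rightarrow> com" where "advance i \<equiv> Write 6 (Const i) (Add (ptr i) (Const 1))"
abbreviation unvisited :: "aexp \<Rightarrow> bexp" where "unvisited a \<equiv> Less (Read 4 a) (Const 1)"

definition attach :: "nat \<Rightarrow> (nat \<Rightarrow> nat \<Rightarrow> nat) \<Rightarrow> nat \<Rightarrow> com" where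
  "attach K hang i = switch (state i) K (\<lambda>a. switch (state (Suc i)) K (\<lambda>b.
     Write 7 (Const i) (Const (hang a b))))"

text \<open>Processes a visited neighbour. If it is on the search path, then this records an
  edge to an ancestor; otherwise it is a descendant, whose edge to the current vertex has been
  recorded from below.\<close>

primrec mark_back_edge :: "nat \<Rightarrow> (nat \<Rightarrow> nat \<Rightarrow> nat) \<Rightarrow> nat \<Rightarrow> nat \<Rightarrow> com" where
  "mark_back_edge K link i 0 = Skip"
| "mark_back_edge K link i (Suc j) = Cond (Eq (Read 2 (ptr i)) (cur j))
     (switch (state i) K (\<lambda>a. Write 7 (Const i) (Const (link a j))))
     (mark_back_edge K link i j)"

text \<open>The recursion is over the number of levels that the search may still use, which
  bounds the nesting of the loops. When none is left, the search path would be longer than any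
  path of the graph, so this case is never reached.\<close>

primrec visit :: "nat \<Rightarrow> nat \<Rightarrow> (nat \<Rightarrow> nat \<Rightarrow> nat) \<Rightarrow> (nat \<Rightarrow> nat \<Rightarrow> nat) \<Rightarrow> nat \<Rightarrow> nat \<Rightarrow> com" where
  "visit K node link hang 0 i = Skip"
| "visit K node link hang (Suc k) i =
     Seq (Write 4 (cur i) (Const 1))
    (Seq (Write 6 (Const i) (Read 1 (cur i)))
    (Seq (Write 7 (Const i) (Const node))
    (While (Less (ptr i) (Read 1 (Add (cur i) (Const 1))))
      (Seq
        (Cond (unvisited (Read 2 (ptr i)))
          (Seq (Write 5 (Const (Suc i)) (Read 2 (ptr i)))
          (Seq (visit K node link hang k (Suc i))
               (attach K hang i)))
          (mark_back_edge K link i i))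
        (advance i)))))"

text \<open>The number of vertices serves as the name of the artificial root, as it is not the
  number of a vertex.\<close>

definition evaluate ::
  "nat \<Rightarrow> nat \<Rightarrow> (nat \<Rightarrow> nat \<Rightarrow> nat) \<Rightarrow> (nat \<Rightarrow> nat \<Rightarrow> nat) \<Rightarrow> (nat \<Rightarrow> nat) \<Rightarrow> nat \<Rightarrow> com" where
  "evaluate K node link hang out D =
     Seq (Write 5 (Const 0) (Read 0 (Const 0)))
    (Seq (Write 7 (Const 0) (Const node))
    (Seq (While (Less (ptr 0) (Read 0 (Const 0)))
      (Seq
        (Cond (unvisited (ptr 0))
          (Seq (Write 5 (Const (Suc 0)) (ptr 0))
          (Seq (visit K node link hang D (Suc 0))
               (attach K hang 0)))
          Skip)
        (advance 0)))
    (switch (state 0) K (\<lambda>a. Write 3 (Const 0) (Const (out a))))))"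

lemma runs_mark_back_edge:
  assumes "\<And>j. j < m \<Longrightarrow> s 5 j = anc ! j" "s 7 i < K" "\<And>j. link (s 7 i) j \<le> w" "i \<le> w"
  shows "(\<exists>j<m. anc ! j = s 2 (s 6 i) \<and>
      runs w (mark_back_edge K link i m) s (m + K + 1) (store s 7 i (link (s 7 i) j))) \<or>
    (\<forall>j<m. anc ! j \<noteq> s 2 (s 6 i)) \<and> runs w (mark_back_edge K link i m) s (m + K + 1) s"
  using assms(1)
proof (induction m)
  case 0
  then show ?case using runs_mono[OF runs_Skip] by simp
next
  case (Suc m)
  show ?case
  proof (cases "anc ! m = s 2 (s 6 i)")
    case True
    have "runs w (switch (state i) K (\<lambda>a. Write 7 (Const i) (Const (link a m)))) s (1 + K)
        (store s 7 i (link (s 7 i) m))"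
      by (rule runs_switch[where x = "s 7 i"], simp, rule assms, rule runs_Write)
        (use assms in simp_all)
    then have "runs w (switch (state i) K (\<lambda>a. Write 7 (Const i) (Const (link a m)))) s (m + K + 1)
        (store s 7 i (link (s 7 i) m))"
      by (rule runs_mono) simp
    then have "runs w (mark_back_edge K link i (Suc m)) s (Suc (m + K + 1))
        (store s 7 i (link (s 7 i) m))"
      unfolding mark_back_edge.simps by (rule runs_Cond) (use True Suc.prems in simp_all)
    then show ?thesis
      using True by (intro disjI1 exI[of _ m]) (simp del: store_apply mark_back_edge.simps)
  next
    case False
    then have skip: "\<And>s'. runs w (mark_back_edge K link i m) s (m + K + 1) s' \<Longrightarrow>
        runs w (mark_back_edge K link i (Suc m)) s (Suc (m + K + 1)) s'"
      unfolding mark_back_edge.simps by (intro runs_Cond) (use Suc.prems in simp_all)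
    have "(\<exists>j<m. anc ! j = s 2 (s 6 i) \<and>
        runs w (mark_back_edge K link i m) s (m + K + 1) (store s 7 i (link (s 7 i) j))) \<or>
      (\<forall>j<m. anc ! j \<noteq> s 2 (s 6 i)) \<and> runs w (mark_back_edge K link i m) s (m + K + 1) s"
      by (rule Suc.IH) (simp add: Suc.prems)
    then show ?thesis
      using skip False less_SucI less_Suc_eq by (metis add_Suc)
  qed
qed

lemma runs_attach:
  assumes "s 7 i < K" "s 7 (Suc i) < K" "hang (s 7 i) (s 7 (Suc i)) \<le> w" "i \<le> w"
  shows "runs w (attach K hang i) s (1 + K + K) (store s 7 i (hang (s 7 i) (s 7 (Suc i))))"
  unfolding attach_def
  by (rule runs_switch[where x = "s 7 i"], simp, rule assms,
      rule runs_switch[where x = "s 7 (Suc i)"], simp, rule assms, rule runs_Write)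
    (use assms in simp_all)

text \<open>The state of a term has to be computable from the states of its parts; which
  automaton it is does not matter for the search. \<open>w\<close> is the bound on the numbers
  in memory.\<close>

locale depth_first_search =
  fixes adj :: "nat list list" and w D K :: nat
    and code :: "nat tree \<Rightarrow> nat" and node link hang
  assumes nbr_less: "\<And>i j. i < length adj \<Longrightarrow> j \<in> set (adj ! i) \<Longrightarrow> j < length adj"
    and nbr_sym: "\<And>i j. i < length adj \<Longrightarrow> j \<in> set (adj ! i) \<Longrightarrow> i \<in> set (adj ! j)"
    and nbr_irrefl: "\<And>i. i < length adj \<Longrightarrow> i \<notin> set (adj ! i)"
    and path_length: "\<And>p. distinct p \<Longrightarrow> set p \<subseteq> {..<length adj} \<Longrightarrow>
      successively (\<lambda>u v. v \<in> set (adj ! u)) p \<Longrightarrow> length p \<le> D"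
    and code_less: "\<And>t. code t < K"
    and code_Node: "\<And>v. code (Node v) = node"
    and code_Link: "\<And>t j. code (Link t j) = link (code t) j"
    and code_Hang: "\<And>t c. code (Hang t c) = hang (code t) (code c)"
    and word: "length adj \<le> w" "length (concat adj) \<le> w" "Suc D \<le> w" "K \<le> w"
begin

definition n where "n = length adj"
definition nb where "nb v = set (adj ! v)"
definition deg where "deg v = length (adj ! v)"
definition offset where "offset v = length (concat (take v adj))"
definition incident where "incident A = {{u, v} | u v. u \<in> A \<and> v \<in> nb u}"
definition visited where "visited s = {u. s (4::nat) u \<noteq> (0::nat)}"
definition has_input where "has_input s \<longleftrightarrow> (\<forall>k<3. s k = input_memory adj k)"

text \<open>A search at depth \<open>i\<close> leaves the input and the levels above it
  alone.\<close>

definition same_below :: "nat \<Rightarrow> memory \<Rightarrow> memory \<Rightarrow> bool" where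
  "same_below i s s' \<longleftrightarrow> (\<forall>k<3. s' k = s k) \<and> (\<forall>k\<in>{5,6,7}. \<forall>j<i. s' k j = s k j)"

text \<open>Apart from the time of the search at a child, an iteration consults the transition
  table by at most \<open>2 * K\<close> comparisons, or compares a neighbour with the at most
  \<open>D\<close> vertices of the search path and then makes \<open>K\<close> comparisons; the
  summands \<open>10\<close> are generous bounds for the single steps around them.\<close>

definition iter_cost where "iter_cost = 2 * K + D + 10"
definition cost where "cost = iter_cost + 10"
definition work where "work A = (\<Sum>u\<in>A. 1 + deg u)"

lemma word_code: "code t \<le> w"
  using code_less[of t] word(4) by simp

lemma input_count: "has_input s \<Longrightarrow> s 0 0 = n"
  by (simp add: has_input_def input_memory_def array_of_def n_def)

lemma input_offset: "has_input s \<Longrightarrow> v \<le> n \<Longrightarrow> s 1 v = offset v"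
  by (simp add: has_input_def input_memory_def array_of_def n_def offset_def nth_append)

lemma offset_Suc: "v < n \<Longrightarrow> offset (Suc v) = offset v + deg v"
  by (simp add: offset_def deg_def n_def take_Suc_conv_app_nth)

lemma offset_le: "offset v \<le> length (concat adj)"
  unfolding offset_def
  by (metis append_take_drop_id concat_append length_append le_add1)

lemma input_neighbour:
  assumes "has_input s" "v < n" "l < deg v"
  shows "s 2 (offset v + l) = adj ! v ! l"
proof -
  have "concat adj = concat (take v adj) @ adj ! v @ concat (drop (Suc v) adj)"
    using assms(2) unfolding n_def
    by (metis concat.simps(2) concat_append id_take_nth_drop)
  moreover have "offset v + l < length (concat adj)"
    using offset_le[of "Suc v"] offset_Suc[OF assms(2)] assms(3) by simp
  ultimately show ?thesis
    using assms by (simp add: has_input_def input_memory_def array_of_def offset_def deg_def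
        nth_append)
qed

lemma work_Un: "finite A \<Longrightarrow> finite B \<Longrightarrow> A \<inter> B = {} \<Longrightarrow> work (A \<union> B) = work A + work B"
  unfolding work_def by (rule sum.union_disjoint)

lemma nb_closed:
  assumes "incident A \<subseteq> edges anc t" "bounded_tree k (length anc) t" "u \<in> A" "v \<in> nb u"
  shows "v \<in> verts t \<union> set anc"
proof -
  have "{u, v} \<in> edges anc t" using assms(1,3,4) by (auto simp: incident_def)
  then have "{u, v} \<subseteq> verts t \<union> set anc" using assms(2) by (rule edges_subset)
  then show ?thesis by simp
qed

lemma has_input_store: "3 \<le> k \<Longrightarrow> has_input (store s k a x) \<longleftrightarrow> has_input s"
  by (simp add: has_input_def store_other)

lemma visited_store: "k \<noteq> 4 \<Longrightarrow> visited (store s k a x) = visited s"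
  by (simp add: visited_def store_other)

lemma visited_mark: "visited (store s 4 a 1) = insert a (visited s)"
  by (auto simp: visited_def)

lemma same_below_refl: "same_below i s s"
  by (simp add: same_below_def)

lemma same_below_trans:
  "same_below i s s' \<Longrightarrow> same_below j s' s'' \<Longrightarrow> i \<le> j \<Longrightarrow> same_below i s s''"
  by (auto simp: same_below_def)

lemma same_below_store: "3 \<le> k \<Longrightarrow> i \<le> a \<or> k = 4 \<Longrightarrow> same_below i s (store s k a x)"
  by (auto simp: same_below_def store_other)

lemma same_below_input: "same_below i s s' \<Longrightarrow> has_input s \<Longrightarrow> has_input s'"
  by (simp add: same_below_def has_input_def)

lemma same_below_nth: "same_below i s s' \<Longrightarrow> k \<in> {5, 6, 7} \<Longrightarrow> j < i \<Longrightarrow> s' k j = s k j"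
  by (auto simp: same_below_def)

lemma incident_Un: "incident (A \<union> B) = incident A \<union> incident B"
  by (auto simp: incident_def)

text \<open>Without the artificial root, the search path is a path of the graph.\<close>

lemma stack_height:
  assumes "length anc = i" "0 < i" "v < n" "v \<notin> X" "set anc \<subseteq> insert n X" "distinct (tl anc)"
    "set (tl anc) \<subseteq> {..<n}" "successively (\<lambda>u v. v \<in> nb u) (tl anc @ [v])"
  shows "i \<le> D"
proof -
  have "set (tl anc) \<subseteq> set anc" by (cases anc) auto
  then have "v \<notin> set (tl anc)" using assms(3-5) by auto
  then have "length (tl anc @ [v]) \<le> D"
    using assms(3,6-8) by (intro path_length) (auto simp: n_def nb_def)
  then show ?thesis using assms(1,2) by simp
qed

text \<open>The search path consists of \<open>anc\<close> and the new vertex \<open>v\<close>.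
  All neighbours of a vertex that has been left are visited. Hence the vertices discovered from
  \<open>v\<close> are not adjacent to a vertex that had been left before, and all edges at a
  vertex of the resulting tree go to the tree or to \<open>anc\<close>. The term for
  \<open>v\<close> therefore records exactly the edges incident with its vertices. While the
  list of \<open>v\<close> is being scanned, this holds for the descendants of \<open>v\<close>,
  and for \<open>v\<close> itself up to the current position.\<close>

lemma visit_correct:
  assumes "has_input s" "length anc = i" "\<And>j. j < i \<Longrightarrow> s 5 j = anc ! j" "s 5 i = v"
    and "v < n" "v \<notin> visited s" "set anc \<subseteq> insert n (visited s)" "visited s \<subseteq> {..<n}"
    and "\<And>u. u \<in> visited s - set anc \<Longrightarrow> nb u \<subseteq> visited s"
    and "0 < i" "distinct (tl anc)" "set (tl anc) \<subseteq> {..<n}"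
    and "successively (\<lambda>u v. v \<in> nb u) (tl anc @ [v])" "D < i + k"
  shows "\<exists>s' t T. runs w (visit K node link hang k i) s T s' \<and> T \<le> cost * work (verts t) \<and>
    same_below i s s' \<and> s' 5 i = v \<and> root t = v \<and> distinct_tree t \<and> verts t \<inter> visited s = {} \<and>
    verts t \<subseteq> {..<n} \<and> visited s' = visited s \<union> verts t \<and> edges anc t = incident (verts t) \<and>
    0 < k \<and> bounded_tree (k - 1) i t \<and> s' 7 i = code t"
  using assms
proof (induction k arbitrary: s anc i v)
  case 0
  have "i \<le> D"
    by (rule stack_height[of anc i v "visited s"]) (use 0 in \<open>simp_all\<close>)
  then show ?case using 0 by simp
next
  case (Suc k)
  note input = Suc.prems(1) and anc = Suc.prems(2,3) and v = Suc.prems(5,6)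
    and stack = Suc.prems(7) and vis = Suc.prems(8) and black = Suc.prems(9)
    and path = Suc.prems(10-13)
  define X where "X = visited s"
  have iD: "i \<le> D"
    by (rule stack_height[of anc i v "visited s"]) (use Suc.prems in \<open>simp_all\<close>)
  have v_anc: "v \<notin> set anc" using v stack by auto
  define I where "I l s' \<tau> \<longleftrightarrow> (\<exists>t. same_below i s s' \<and> s' 5 i = v \<and> s' 6 i = offset v + l \<and>
      s' 7 i = code t \<and> visited s' = X \<union> verts t \<and> root t = v \<and> distinct_tree t \<and>
      verts t \<inter> X = {} \<and> verts t \<subseteq> {..<n} \<and> bounded_tree k i t \<and>
      edges anc t = incident (verts t - {v}) \<union> {{v, x} | x. x \<in> set (take l (adj ! v))} \<and>
      \<tau> \<le> iter_cost * l + cost * work (verts t - {v}))" for l s' \<tau>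
  let ?body = "Seq
        (Cond (unvisited (Read 2 (ptr i)))
          (Seq (Write 5 (Const (Suc i)) (Read 2 (ptr i)))
          (Seq (visit K node link hang k (Suc i))
               (attach K hang i)))
          (mark_back_edge K link i i))
        (advance i)"
  let ?guard = "Less (ptr i) (Read 1 (Add (cur i) (Const 1)))"
  have guard: "bval ?guard s' \<longleftrightarrow> l < deg v" if "I l s' \<tau>" for l s' \<tau>
  proof -
    have "has_input s'" using that input same_below_input by (auto simp: I_def)
    then have "s' 1 (Suc v) = offset v + deg v"
      using input_offset[of s' "Suc v"] offset_Suc[of v] v(1) by simp
    then show ?thesis using that by (auto simp: I_def)
  qed
  have step: "\<exists>s'' T. runs w ?body s' T s'' \<and> I (Suc l) s'' (\<tau> + Suc T)"
    if l: "l < deg v" and I: "I l s' \<tau>" for l s' \<tau>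
  proof -
    obtain t where same: "same_below i s s'" and s': "s' 5 i = v" "s' 6 i = offset v + l"
      "s' 7 i = code t" and vis': "visited s' = X \<union> verts t" and t: "root t = v" "distinct_tree t"
      "verts t \<inter> X = {}" "verts t \<subseteq> {..<n}" "bounded_tree k i t"
      and edges: "edges anc t = incident (verts t - {v}) \<union> {{v, x} | x. x \<in> set (take l (adj ! v))}"
      and \<tau>: "\<tau> \<le> iter_cost * l + cost * work (verts t - {v})"
      using I unfolding I_def by (elim exE conjE)
    have input': "has_input s'" using same input by (rule same_below_input)
    define x where "x = adj ! v ! l"
    have x_read: "s' 2 (offset v + l) = x"
      unfolding x_def by (rule input_neighbour[OF input' v(1) l])
    have x: "x \<in> nb v" using l by (simp add: x_def nb_def deg_def)
    have xn: "x < n" and vx: "v \<in> nb x" and "x \<noteq> v"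
      using x v(1) nbr_less[of v x] nbr_sym[of v x] nbr_irrefl[of v] by (auto simp: n_def nb_def)
    have take_Suc: "set (take (Suc l) (adj ! v)) = insert x (set (take l (adj ! v)))"
      using l by (simp add: take_Suc_conv_app_nth x_def deg_def)
    have vt: "v \<in> verts t" using t(1) root_in_verts[of t] by simp
    have anc': "s' 5 j = anc ! j" if "j < i" for j
      using same_below_nth[OF same, of 5 j] anc(2) that by simp
    have ptr_le: "Suc (offset v + l) \<le> w"
      using offset_le[of "Suc v"] offset_Suc[OF v(1)] l word(2) by simp
    have iw: "Suc i \<le> w" using iD word(3) by simp
    have advance: "runs w (advance i) s'' 1 (store s'' 6 i (offset v + Suc l))"
      if "s'' 6 i = offset v + l" for s''
      by (rule runs_Write) (use that ptr_le iw in simp_all)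
    show ?thesis
    proof (cases "s' 4 x = 0")
      case True
      \<comment> \<open>\<open>x\<close> becomes a child of \<open>v\<close>; the edge between them is recorded from \<open>x\<close>, as an edge to an ancestor.\<close>
      define s1 where "s1 = store s' 5 (Suc i) x"
      have run1: "runs w (Write 5 (Const (Suc i)) (Read 2 (ptr i))) s' 1 s1"
        unfolding s1_def by (rule runs_Write) (use s' x_read xn word(1) iw in \<open>simp_all add: n_def\<close>)
      have vis1: "visited s1 = X \<union> verts t" by (simp add: s1_def visited_store vis')
      have same1: "same_below (Suc i) s' s1" unfolding s1_def by (rule same_below_store) simp_all
      have "\<exists>s2 c T. runs w (visit K node link hang k (Suc i)) s1 T s2 \<and> T \<le> cost * work (verts c) \<and>
        same_below (Suc i) s1 s2 \<and> s2 5 (Suc i) = x \<and> root c = x \<and> distinct_tree c \<and>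
        verts c \<inter> visited s1 = {} \<and> verts c \<subseteq> {..<n} \<and> visited s2 = visited s1 \<union> verts c \<and>
        edges (anc @ [v]) c = incident (verts c) \<and>
        0 < k \<and> bounded_tree (k - 1) (Suc i) c \<and> s2 7 (Suc i) = code c"
      proof (rule Suc.IH)
        show "has_input s1" by (simp add: s1_def has_input_store input')
        show "length (anc @ [v]) = Suc i" using anc(1) by simp
        show "s1 5 j = (anc @ [v]) ! j" if "j < Suc i" for j
          using that anc' anc(1) s'(1) by (auto simp: s1_def nth_append less_Suc_eq)
        show "s1 5 (Suc i) = x" by (simp add: s1_def)
        show "x \<notin> visited s1" using True unfolding s1_def by (simp add: visited_def)
        show "set (anc @ [v]) \<subseteq> insert n (visited s1)" using stack vt vis1 by (auto simp: X_def)
        show "visited s1 \<subseteq> {..<n}" using vis t(4) vis1 by (auto simp: X_def)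
        show "nb u \<subseteq> visited s1" if u: "u \<in> visited s1 - set (anc @ [v])" for u
        proof (cases "u \<in> X")
          case True
          then show ?thesis using black[of u] u vis1 by (auto simp: X_def)
        next
          case False
          then have u': "u \<in> verts t - {v}" using u vis1 by auto
          show ?thesis
          proof
            fix y assume y: "y \<in> nb u"
            have "y \<in> verts t \<union> set anc"
              by (rule nb_closed[of "verts t - {v}" anc t k u]) (use edges t(5) u' y anc(1) in auto)
            moreover have "y \<noteq> n" using nbr_less[of u y] y u' t(4) by (auto simp: n_def nb_def)
            ultimately show "y \<in> visited s1" using stack vis1 by (auto simp: X_def)
          qed
        qed
        have "anc \<noteq> []" using anc(1) path(1) by auto
        then have tl: "tl (anc @ [v]) = tl anc @ [v]" by simp
        have "set (tl anc) \<subseteq> set anc" by (cases anc) auto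
        then show "distinct (tl (anc @ [v]))" using path(2) v_anc by (auto simp: tl)
        show "set (tl (anc @ [v])) \<subseteq> {..<n}" using path(3) v(1) by (simp add: tl)
        show "successively (\<lambda>u v. v \<in> nb u) (tl (anc @ [v]) @ [x])"
          using path(4) x by (simp add: tl successively_append_iff)
      qed (use xn Suc.prems(14) in simp_all)
      then obtain s2 c T where run2: "runs w (visit K node link hang k (Suc i)) s1 T s2"
        and T: "T \<le> cost * work (verts c)" and same2: "same_below (Suc i) s1 s2"
        and c: "root c = x" "distinct_tree c" "verts c \<inter> visited s1 = {}" "verts c \<subseteq> {..<n}"
        and vis2: "visited s2 = visited s1 \<union> verts c"
        and edges_c: "edges (anc @ [v]) c = incident (verts c)"
        and c_bounded: "0 < k" "bounded_tree (k - 1) (Suc i) c" and s2: "s2 7 (Suc i) = code c"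
        by blast
      have same12: "same_below (Suc i) s' s2" using same_below_trans[OF same1 same2] by simp
      have s2': "s2 5 i = v" "s2 6 i = offset v + l" "s2 7 i = code t"
        using same_below_nth[OF same12, of _ i] s' by simp_all
      define s3 where "s3 = store s2 7 i (code (Hang t c))"
      have run3: "runs w (attach K hang i) s2 (1 + K + K) s3"
        using runs_attach[of s2 i K hang w] s2 s2' code_less[of t] code_less[of c]
          word_code[of "Hang t c"] iw
        by (simp add: s3_def code_Hang)
      define s4 where "s4 = store s3 6 i (offset v + Suc l)"
      have run4: "runs w (advance i) s3 1 s4"
        unfolding s4_def by (rule advance) (simp add: s3_def s2')
      have "runs w (Cond (unvisited (Read 2 (ptr i)))
          (Seq (Write 5 (Const (Suc i)) (Read 2 (ptr i)))
          (Seq (visit K node link hang k (Suc i)) (attach K hang i)))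
          (mark_back_edge K link i i)) s' (Suc (1 + (T + (1 + K + K)))) s3"
        by (rule runs_Cond, rule runs_Seq[OF run1 runs_Seq[OF run2 run3]])
          (use True s' x_read in simp_all)
      then have "runs w ?body s' (Suc (1 + (T + (1 + K + K))) + 1) s4" using run4 by (rule runs_Seq)
      moreover have "I (Suc l) s4 (\<tau> + Suc (Suc (1 + (T + (1 + K + K))) + 1))"
        unfolding I_def
      proof (intro exI[of _ "Hang t c"] conjI)
        have "same_below i s2 s3" unfolding s3_def by (rule same_below_store) simp_all
        moreover have "same_below i s3 s4" unfolding s4_def by (rule same_below_store) simp_all
        ultimately show "same_below i s s4"
          using same same12 by (meson same_below_trans le_refl le_SucI)
        show "s4 5 i = v" "s4 6 i = offset v + Suc l" "s4 7 i = code (Hang t c)"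
          by (simp_all add: s4_def s3_def s2')
        show "visited s4 = X \<union> verts (Hang t c)"
          by (simp add: s4_def s3_def visited_store vis2 vis1 Un_assoc)
        show "distinct_tree (Hang t c)" using t(2) c(2,3) vis1 by auto
        show "verts (Hang t c) \<inter> X = {}" using t(3) c(3) vis1 by auto
        show "bounded_tree k i (Hang t c)" using t(5) c_bounded by simp
        have vc: "v \<notin> verts c" using c(3) vis1 vt by auto
        then have split: "verts (Hang t c) - {v} = (verts t - {v}) \<union> verts c" by auto
        have "{v, x} \<in> incident (verts c)"
          using vx c(1) root_in_verts[of c] by (auto simp: incident_def insert_commute)
        then show "edges anc (Hang t c) = incident (verts (Hang t c) - {v}) \<union>
            {{v, y} | y. y \<in> set (take (Suc l) (adj ! v))}"
          unfolding split incident_Un take_Suc using edges edges_c t(1) by auto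
        have "work (verts (Hang t c) - {v}) = work (verts t - {v}) + work (verts c)"
          unfolding split by (rule work_Un) (use c(3) vis1 in auto)
        then have "cost * work (verts (Hang t c) - {v}) =
            cost * work (verts t - {v}) + cost * work (verts c)"
          by (simp add: distrib_left)
        then show "\<tau> + Suc (Suc (1 + (T + (1 + K + K))) + 1) \<le>
            iter_cost * Suc l + cost * work (verts (Hang t c) - {v})"
          using \<tau> T by (simp add: iter_cost_def)
      qed (use t c in simp_all)
      ultimately show ?thesis by blast
    next
      case False
      then have xvis: "x \<in> X \<union> verts t" using vis' by (auto simp: visited_def)
      have "\<exists>s1 u. runs w (mark_back_edge K link i i) s' (i + K + 1) s1 \<and>
        (s1 = s' \<or> s1 = store s' 7 i (code u)) \<and> s1 7 i = code u \<and> root u = v \<and> distinct_tree u \<and>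
        verts u = verts t \<and> bounded_tree k i u \<and> edges anc u = insert {v, x} (edges anc t)"
      proof -
        have "link (s' 7 i) j \<le> w" for j using word_code[of "Link t j"] s'(3) by (simp add: code_Link)
        then consider j where "j < i" "anc ! j = x"
          "runs w (mark_back_edge K link i i) s' (i + K + 1) (store s' 7 i (link (s' 7 i) j))"
        | "\<forall>j<i. anc ! j \<noteq> x" "runs w (mark_back_edge K link i i) s' (i + K + 1) s'"
          using runs_mark_back_edge[of i s' anc i K link w] anc' s' x_read code_less[of t] iw by auto
        then show ?thesis
        proof cases
          case 1
          then show ?thesis using t s'(3)
            by (intro exI[of _ "store s' 7 i (code (Link t j))"] exI[of _ "Link t j"])
              (simp add: code_Link)
        next
          case 2
          have "x \<notin> set anc" using 2(1) anc(1) by (auto simp: in_set_conv_nth)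
          \<comment> \<open>Had \<open>x\<close> been left before \<open>v\<close> was reached, then \<open>v\<close> would have been visited from \<open>x\<close>.\<close>
          have "x \<in> verts t - {v}"
          proof (rule ccontr)
            assume "\<not> ?thesis"
            then have "x \<in> X" using xvis \<open>x \<noteq> v\<close> by auto
            then have "nb x \<subseteq> X" using black[of x] \<open>x \<notin> set anc\<close> by (auto simp: X_def)
            then show False using vx v(2) by (auto simp: X_def)
          qed
          then have "{v, x} \<in> edges anc t"
            using vx edges by (auto simp: incident_def insert_commute)
          then show ?thesis using 2 t s'(3)
            by (intro exI[of _ s'] exI[of _ t]) (simp add: insert_absorb)
        qed
      qed
      then obtain s1 u where run1: "runs w (mark_back_edge K link i i) s' (i + K + 1) s1"
        and s1: "s1 = s' \<or> s1 = store s' 7 i (code u)" "s1 7 i = code u"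
        and u: "root u = v" "distinct_tree u" "verts u = verts t" "bounded_tree k i u"
          "edges anc u = insert {v, x} (edges anc t)"
        by blast
      have s1': "s1 5 i = v" "s1 6 i = offset v + l" "visited s1 = visited s'" "same_below i s' s1"
        using s1(1) s' by (auto simp: visited_store intro: same_below_refl same_below_store)
      define s2 where "s2 = store s1 6 i (offset v + Suc l)"
      have run2: "runs w (advance i) s1 1 s2"
        unfolding s2_def by (rule advance) (simp add: s1')
      have "runs w (Cond (unvisited (Read 2 (ptr i)))
          (Seq (Write 5 (Const (Suc i)) (Read 2 (ptr i)))
          (Seq (visit K node link hang k (Suc i)) (attach K hang i)))
          (mark_back_edge K link i i)) s' (Suc (i + K + 1)) s1"
        by (rule runs_Cond) (use False s' x_read run1 in simp_all)
      then have "runs w ?body s' (Suc (i + K + 1) + 1) s2" using run2 by (rule runs_Seq)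
      moreover have "I (Suc l) s2 (\<tau> + Suc (Suc (i + K + 1) + 1))"
        unfolding I_def
      proof (intro exI[of _ u] conjI)
        have "same_below i s1 s2" unfolding s2_def by (rule same_below_store) simp_all
        then show "same_below i s s2"
          using same s1'(4) by (meson same_below_trans le_refl)
        show "s2 5 i = v" "s2 6 i = offset v + Suc l" "s2 7 i = code u"
          by (simp_all add: s2_def s1' s1(2))
        show "visited s2 = X \<union> verts u" by (simp add: s2_def visited_store s1' vis' u)
        show "edges anc u = incident (verts u - {v}) \<union> {{v, y} | y. y \<in> set (take (Suc l) (adj ! v))}"
          unfolding take_Suc u edges by auto
        show "\<tau> + Suc (Suc (i + K + 1) + 1) \<le> iter_cost * Suc l + cost * work (verts u - {v})"
          using \<tau> iD by (simp add: iter_cost_def u)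
      qed (use t u in simp_all)
      ultimately show ?thesis by blast
    qed
  qed
  define s0 where "s0 = store (store (store s 4 v 1) 6 i (offset v)) 7 i node"
  have iw: "Suc i \<le> w" using iD word(3) by simp
  have "I 0 s0 0"
    unfolding I_def
  proof (intro exI[of _ "Node v"] conjI)
    have "same_below i s (store s 4 v 1)"
      "same_below i (store s 4 v 1) (store (store s 4 v 1) 6 i (offset v))"
      "same_below i (store (store s 4 v 1) 6 i (offset v)) s0"
      unfolding s0_def by (rule same_below_store; simp)+
    then show "same_below i s s0" by (meson same_below_trans le_refl)
    show "visited s0 = X \<union> verts (Node v)"
      by (simp add: s0_def visited_store visited_mark[unfolded One_nat_def] X_def)
  qed (use v Suc.prems(4) in \<open>simp_all add: s0_def code_Node X_def incident_def\<close>)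
  then obtain s' T \<tau>' where loop: "runs w (While ?guard ?body) s0 T s'" "I (deg v) s' \<tau>'" "T \<le> Suc \<tau>'"
    using runs_loop[of "deg v" I ?guard w ?body 0 s0 0] step guard by auto
  have "runs w (Write 4 (cur i) (Const 1)) s 1 (store s 4 v 1)"
    by (rule runs_Write) (use Suc.prems(4) v(1) word(1) iw in \<open>simp_all add: n_def\<close>)
  moreover have "runs w (Write 6 (Const i) (Read 1 (cur i))) (store s 4 v 1) 1
      (store (store s 4 v 1) 6 i (offset v))"
    by (rule runs_Write)
      (use Suc.prems(4) v(1) input_offset[OF input, of v] offset_le[of v] word(2) iw in simp_all)
  moreover have "runs w (Write 7 (Const i) (Const node)) (store (store s 4 v 1) 6 i (offset v)) 1 s0"
    unfolding s0_def
    by (rule runs_Write) (use word_code[of "Node v"] iw in \<open>simp_all add: code_Node\<close>)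
  ultimately have run: "runs w (visit K node link hang (Suc k) i) s (1 + (1 + (1 + T))) s'"
    unfolding visit.simps using loop(1) by (intro runs_Seq)
  obtain t where same: "same_below i s s'" and s': "s' 5 i = v" "s' 7 i = code t"
    and vis': "visited s' = X \<union> verts t" and t: "root t = v" "distinct_tree t"
      "verts t \<inter> X = {}" "verts t \<subseteq> {..<n}" "bounded_tree k i t"
    and edges: "edges anc t = incident (verts t - {v}) \<union>
      {{v, x} | x. x \<in> set (take (deg v) (adj ! v))}"
    and \<tau>: "\<tau>' \<le> iter_cost * deg v + cost * work (verts t - {v})"
    using loop(2) unfolding I_def by (elim exE conjE)
  have vt: "v \<in> verts t" using t(1) root_in_verts[of t] by simp
  then have split: "verts t = (verts t - {v}) \<union> {v}" by auto
  have "edges anc t = incident (verts t)"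
    by (subst split, subst incident_Un) (use edges in \<open>simp add: incident_def nb_def deg_def\<close>)
  moreover have "1 + (1 + (1 + T)) \<le> cost * work (verts t)"
  proof -
    have "work (verts t) = work (verts t - {v}) + (1 + deg v)"
      by (subst split, subst work_Un) (simp_all add: work_def)
    then have "cost * work (verts t) = cost * work (verts t - {v}) + cost + cost * deg v"
      by (simp add: distrib_left)
    moreover have "iter_cost * deg v \<le> cost * deg v" by (simp add: cost_def)
    moreover have "10 \<le> cost" by (simp add: cost_def)
    ultimately show ?thesis using \<tau> loop(3) by linarith
  qed
  ultimately show ?case
    using run same s' vis' t by (intro exI[of _ s'] exI[of _ t] exI[of _ "1 + (1 + (1 + T))"])
      (simp add: X_def)
qed

end

context depth_first_search
begin

lemma nb_lt: "u < n \<Longrightarrow> nb u \<subseteq> {..<n}"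
  using nbr_less by (auto simp: n_def nb_def)

text \<open>The outer loop is a search at the artificial root, whose adjacency list is the list
  of all vertices; no edges to this root are recorded for its children.\<close>

lemma evaluate_correct:
  assumes out: "\<And>a. a < K \<Longrightarrow> out a \<le> w"
  shows "\<exists>s' t T. runs w (evaluate K node link hang out D) (input_memory adj) T s' \<and>
    T \<le> cost * (n + work {..<n} + 1) \<and> s' 3 0 = out (code t) \<and>
    bounded_tree D 0 t \<and> distinct_tree t \<and> verts_below t = {..<n} \<and> edges_below t = incident {..<n}"
proof -
  let ?s = "input_memory adj"
  have input: "has_input ?s" by (simp add: has_input_def)
  have zero: "?s k a = 0" if "3 \<le> k" for k a using that by (simp add: input_memory_def)
  define I where "I l s' \<tau> \<longleftrightarrow> (\<exists>t. same_below 0 ?s s' \<and> s' 5 0 = n \<and> s' 6 0 = l \<and>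
      s' 7 0 = code t \<and> verts t = insert n (visited s') \<and> root t = n \<and> distinct_tree t \<and>
      visited s' \<subseteq> {..<n} \<and> {..<l} \<subseteq> visited s' \<and> bounded_tree D 0 t \<and>
      edges [] t = incident (visited s') \<and>
      \<tau> \<le> iter_cost * l + cost * work (visited s'))" for l s' \<tau>
  let ?body = "Seq
        (Cond (unvisited (ptr 0))
          (Seq (Write 5 (Const (Suc 0)) (ptr 0))
          (Seq (visit K node link hang D (Suc 0))
               (attach K hang 0)))
          Skip)
        (advance 0)"
  let ?guard = "Less (ptr 0) (Read 0 (Const 0))"
  have guard: "bval ?guard s' \<longleftrightarrow> l < n" if "I l s' \<tau>" for l s' \<tau>
  proof -
    have "has_input s'" using that input same_below_input by (auto simp: I_def)
    then show ?thesis using that input_count[of s'] by (auto simp: I_def)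
  qed
  have step: "\<exists>s'' T. runs w ?body s' T s'' \<and> I (Suc l) s'' (\<tau> + Suc T)"
    if l: "l < n" and I: "I l s' \<tau>" for l s' \<tau>
  proof -
    obtain t where same: "same_below 0 ?s s'" and s': "s' 5 0 = n" "s' 6 0 = l" "s' 7 0 = code t"
      and t: "verts t = insert n (visited s')" "root t = n" "distinct_tree t" "bounded_tree D 0 t"
      and vis: "visited s' \<subseteq> {..<n}" "{..<l} \<subseteq> visited s'"
      and edges: "edges [] t = incident (visited s')"
      and \<tau>: "\<tau> \<le> iter_cost * l + cost * work (visited s')"
      using I unfolding I_def by (elim exE conjE)
    have input': "has_input s'" using same input by (rule same_below_input)
    have lw: "Suc l \<le> w" and w1: "1 \<le> w" using l word(1) by (simp_all add: n_def)
    have advance: "runs w (advance 0) s'' 1 (store s'' 6 0 (Suc l))" if "s'' 6 0 = l" for s''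
      by (rule runs_Write) (use that lw in simp_all)
    show ?thesis
    proof (cases "s' 4 l = 0")
      case True
      define s1 where "s1 = store s' 5 (Suc 0) l"
      have run1: "runs w (Write 5 (Const (Suc 0)) (ptr 0)) s' 1 s1"
        unfolding s1_def by (rule runs_Write) (use s' lw w1 in simp_all)
      have vis1: "visited s1 = visited s'" by (simp add: s1_def visited_store)
      have same1: "same_below (Suc 0) s' s1" unfolding s1_def by (rule same_below_store) simp_all
      have "\<exists>s2 c T. runs w (visit K node link hang D (Suc 0)) s1 T s2 \<and> T \<le> cost * work (verts c) \<and>
        same_below (Suc 0) s1 s2 \<and> s2 5 (Suc 0) = l \<and> root c = l \<and> distinct_tree c \<and>
        verts c \<inter> visited s1 = {} \<and> verts c \<subseteq> {..<n} \<and> visited s2 = visited s1 \<union> verts c \<and>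
        edges [n] c = incident (verts c) \<and>
        0 < D \<and> bounded_tree (D - 1) (Suc 0) c \<and> s2 7 (Suc 0) = code c"
      proof (rule visit_correct)
        show "has_input s1" by (simp add: s1_def has_input_store input')
        show "l \<notin> visited s1" using True unfolding vis1 by (simp add: visited_def)
        show "visited s1 \<subseteq> {..<n}" using vis vis1 by simp
        show "nb u \<subseteq> visited s1" if u: "u \<in> visited s1 - set [n]" for u
        proof
          fix y assume y: "y \<in> nb u"
          have "y \<in> verts t \<union> set []"
            by (rule nb_closed[of "visited s'" "[]" t D u]) (use edges t(4) u y vis1 in auto)
          moreover have "y < n" using nb_lt[of u] y u vis(1) vis1 by auto
          ultimately show "y \<in> visited s1" using t(1) vis1 by auto
        qed
      qed (use l s' in \<open>simp_all add: s1_def\<close>)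
      then obtain s2 c T where run2: "runs w (visit K node link hang D (Suc 0)) s1 T s2"
        and T: "T \<le> cost * work (verts c)" and same2: "same_below (Suc 0) s1 s2"
        and c: "root c = l" "distinct_tree c" "verts c \<inter> visited s1 = {}" "verts c \<subseteq> {..<n}"
        and vis2: "visited s2 = visited s1 \<union> verts c"
        and edges_c: "edges [n] c = incident (verts c)"
        and c_bounded: "0 < D" "bounded_tree (D - 1) (Suc 0) c" and s2: "s2 7 (Suc 0) = code c"
        by (elim exE conjE)
      have same12: "same_below (Suc 0) s' s2" using same_below_trans[OF same1 same2] by simp
      have s2': "s2 5 0 = n" "s2 6 0 = l" "s2 7 0 = code t"
        using same_below_nth[OF same12, of _ 0] s' by simp_all
      define s3 where "s3 = store s2 7 0 (code (Hang t c))"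
      have run3: "runs w (attach K hang 0) s2 (1 + K + K) s3"
        using runs_attach[of s2 0 K hang w] s2 s2' code_less[of t] code_less[of c]
          word_code[of "Hang t c"]
        by (simp add: s3_def code_Hang)
      define s4 where "s4 = store s3 6 0 (Suc l)"
      have run4: "runs w (advance 0) s3 1 s4"
        unfolding s4_def by (rule advance) (simp add: s3_def s2')
      have "runs w (Cond (unvisited (ptr 0))
          (Seq (Write 5 (Const (Suc 0)) (ptr 0))
          (Seq (visit K node link hang D (Suc 0)) (attach K hang 0)))
          Skip) s' (Suc (1 + (T + (1 + K + K)))) s3"
        by (rule runs_Cond, rule runs_Seq[OF run1 runs_Seq[OF run2 run3]])
          (use True s' in simp_all)
      then have "runs w ?body s' (Suc (1 + (T + (1 + K + K))) + 1) s4" using run4 by (rule runs_Seq)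
      moreover have "I (Suc l) s4 (\<tau> + Suc (Suc (1 + (T + (1 + K + K))) + 1))"
        unfolding I_def
      proof (intro exI[of _ "Hang t c"] conjI)
        have "same_below 0 s2 s3" unfolding s3_def by (rule same_below_store) simp_all
        moreover have "same_below 0 s3 s4" unfolding s4_def by (rule same_below_store) simp_all
        ultimately show "same_below 0 ?s s4"
          using same same12 by (meson same_below_trans le_refl le_SucI)
        show "s4 5 0 = n" "s4 6 0 = Suc l" "s4 7 0 = code (Hang t c)"
          by (simp_all add: s4_def s3_def s2')
        have vis4: "visited s4 = visited s' \<union> verts c"
          by (simp add: s4_def s3_def visited_store vis2 vis1)
        show "verts (Hang t c) = insert n (visited s4)" by (simp add: vis4 t(1))
        have "n \<notin> verts c" using c(4) by auto
        then show "distinct_tree (Hang t c)" using t(1,3) c(2,3) vis1 by auto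
        show "bounded_tree D 0 (Hang t c)" using t(4) c_bounded by simp
        show "visited s4 \<subseteq> {..<n}" using vis(1) c(4) by (simp add: vis4)
        have "l \<in> verts c" using c(1) root_in_verts[of c] by simp
        then show "{..<Suc l} \<subseteq> visited s4" using vis(2) by (auto simp: vis4 less_Suc_eq)
        show "edges [] (Hang t c) = incident (visited s4)"
          by (simp add: vis4 incident_Un edges edges_c t(2))
        have "work (visited s4) = work (visited s') + work (verts c)"
          unfolding vis4 by (rule work_Un) (use c(3) vis1 finite_subset[OF vis(1)] in auto)
        then have "cost * work (visited s4) = cost * work (visited s') + cost * work (verts c)"
          by (simp add: distrib_left)
        then show "\<tau> + Suc (Suc (1 + (T + (1 + K + K))) + 1) \<le>
            iter_cost * Suc l + cost * work (visited s4)"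
          using \<tau> T by (simp add: iter_cost_def)
      qed (use t in simp_all)
      ultimately show ?thesis by blast
    next
      case False
      then have "l \<in> visited s'" by (simp add: visited_def)
      define s2 where "s2 = store s' 6 0 (Suc l)"
      have "runs w (Cond (unvisited (ptr 0))
          (Seq (Write 5 (Const (Suc 0)) (ptr 0))
          (Seq (visit K node link hang D (Suc 0)) (attach K hang 0)))
          Skip) s' (Suc 1) s'"
        by (rule runs_Cond) (use False s' runs_Skip in simp_all)
      moreover have "runs w (advance 0) s' 1 s2" unfolding s2_def by (rule advance) (rule s')
      ultimately have "runs w ?body s' (Suc 1 + 1) s2" by (rule runs_Seq)
      moreover have "I (Suc l) s2 (\<tau> + Suc (Suc 1 + 1))"
        unfolding I_def
      proof (intro exI[of _ t] conjI)
        have "same_below 0 s' s2" unfolding s2_def by (rule same_below_store) simp_all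
        then show "same_below 0 ?s s2" using same by (meson same_below_trans le_refl)
        have vis2: "visited s2 = visited s'" by (simp add: s2_def visited_store)
        show "verts t = insert n (visited s2)" "visited s2 \<subseteq> {..<n}"
          "edges [] t = incident (visited s2)"
          by (simp_all add: vis2 t(1) vis(1) edges)
        show "{..<Suc l} \<subseteq> visited s2"
          using vis(2) \<open>l \<in> visited s'\<close> by (auto simp: vis2 less_Suc_eq)
        show "\<tau> + Suc (Suc 1 + 1) \<le> iter_cost * Suc l + cost * work (visited s2)"
          using \<tau> by (simp add: iter_cost_def vis2)
      qed (use t s' in \<open>simp_all add: s2_def\<close>)
      ultimately show ?thesis by blast
    qed
  qed
  define s0 where "s0 = store (store ?s 5 0 n) 7 0 node"
  have "I 0 s0 0"
    unfolding I_def
  proof (intro exI[of _ "Node n"] conjI)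
    have "same_below 0 ?s (store ?s 5 0 n)" "same_below 0 (store ?s 5 0 n) s0"
      unfolding s0_def by (rule same_below_store; simp)+
    then show "same_below 0 ?s s0" by (meson same_below_trans le_refl)
    have vis0: "visited s0 = {}" by (simp add: s0_def visited_store) (simp add: visited_def zero)
    show "verts (Node n) = insert n (visited s0)" "visited s0 \<subseteq> {..<n}"
      "{..<0} \<subseteq> visited s0" "edges [] (Node n) = incident (visited s0)"
      by (simp_all add: vis0 incident_def)
  qed (simp_all add: s0_def code_Node zero)
  then obtain s' T \<tau>' where loop: "runs w (While ?guard ?body) s0 T s'" "I n s' \<tau>'" "T \<le> Suc \<tau>'"
    using runs_loop[of n I ?guard w ?body 0 s0 0] step guard by auto
  obtain t where s': "s' 7 0 = code t"
    and t: "verts t = insert n (visited s')" "root t = n" "distinct_tree t" "bounded_tree D 0 t"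
    and vis: "visited s' \<subseteq> {..<n}" "{..<n} \<subseteq> visited s'"
    and edges: "edges [] t = incident (visited s')"
    and \<tau>: "\<tau>' \<le> iter_cost * n + cost * work (visited s')"
    using loop(2) unfolding I_def by (elim exE conjE)
  have all: "visited s' = {..<n}" using vis by auto
  have "runs w (Write 5 (Const 0) (Read 0 (Const 0))) ?s 1 (store ?s 5 0 n)"
    by (rule runs_Write) (use input_count[OF input] word(1) in \<open>simp_all add: n_def\<close>)
  moreover have "runs w (Write 7 (Const 0) (Const node)) (store ?s 5 0 n) 1 s0"
    unfolding s0_def
    by (rule runs_Write) (use word_code[of "Node 0"] in \<open>simp_all add: code_Node\<close>)
  moreover have "runs w (switch (state 0) K (\<lambda>a. Write 3 (Const 0) (Const (out a)))) s' (1 + K)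
      (store s' 3 0 (out (code t)))"
    by (rule runs_switch[where x = "code t"], simp add: s', rule code_less, rule runs_Write)
      (use out[OF code_less[of t]] in simp_all)
  ultimately have "runs w (evaluate K node link hang out D) ?s (1 + (1 + (T + (1 + K))))
      (store s' 3 0 (out (code t)))"
    unfolding evaluate_def using loop(1) by (intro runs_Seq)
  moreover have "1 + (1 + (T + (1 + K))) \<le> cost * (n + work {..<n} + 1)"
  proof -
    have "iter_cost * n \<le> cost * n" by (simp add: cost_def)
    moreover have "K + 4 \<le> cost" by (simp add: cost_def iter_cost_def)
    moreover have "\<tau>' \<le> iter_cost * n + cost * work {..<n}" using \<tau> by (simp only: all)
    moreover have "cost * (n + work {..<n} + 1) = cost * n + cost * work {..<n} + cost"
      by (simp add: distrib_left)
    ultimately show ?thesis using loop(3) by linarith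
  qed
  moreover have "verts_below t = {..<n}" using t(1,2) by (auto simp: verts_below_def all)
  moreover have "edges_below t = incident {..<n}"
    using nb_lt by (fastforce simp: edges_below_def edges all t(2) incident_def)
  ultimately show ?thesis
    using t(3,4) by (intro exI[of _ "store s' 3 0 (out (code t))"] exI[of _ t]
        exI[of _ "1 + (1 + (T + (1 + K)))"]) simp
qed

lemma work_all: "work {..<n} = n + length (concat adj)"
proof -
  have "(\<Sum>u<n. deg u) = sum_list (map length adj)"
    unfolding sum_list_sum_nth by (simp add: deg_def n_def atLeast0LessThan)
  then show ?thesis unfolding work_def sum.distrib length_concat by simp
qed

end

section \<open>Linear time\<close>

text \<open>An entry of the lists is determined by its edge and the direction in which the edge
  is traversed.\<close>

lemma adjacency_length:
  assumes G: "simple_graph V E" and adj: "adjacency_lists V E vs adj"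
  shows "length (concat adj) \<le> 2 * card E"
proof -
  have vs: "distinct vs" "set vs = V" "length adj = length vs"
    and adj_i: "\<And>i. i < length vs \<Longrightarrow> distinct (adj ! i)"
      "\<And>i. i < length vs \<Longrightarrow> set (adj ! i) = {j. j < length vs \<and> {vs ! i, vs ! j} \<in> E}"
    using adj unfolding adjacency_lists_def by blast+
  define A where "A = (SIGMA i:{..<length vs}. set (adj ! i))"
  define g where "g = (\<lambda>(i, j). ({vs ! i, vs ! j}, i < j))"
  have "E \<subseteq> Pow V" "finite V" using G by (auto simp: simple_graph_def)
  then have "finite E" by (meson finite_Pow_iff finite_subset)
  have "length (concat adj) = (\<Sum>i<length vs. card (set (adj ! i)))"
    unfolding length_concat sum_list_sum_nth using adj_i(1) vs(3)
    by (simp add: atLeast0LessThan distinct_card)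
  also have "\<dots> = card A" unfolding A_def by simp
  also have "\<dots> \<le> card (E \<times> (UNIV :: bool set))"
  proof (rule card_inj_on_le)
    have ne: "i \<noteq> j" if "i < length vs" "{vs ! i, vs ! j} \<in> E" for i j
      using that G by (auto simp: simple_graph_def)
    show "inj_on g A"
    proof (rule inj_onI)
      fix x y assume xy: "x \<in> A" "y \<in> A" "g x = g y"
      obtain i j i' j' where [simp]: "x = (i, j)" "y = (i', j')" by (cases x, cases y) auto
      have lt: "i < length vs" "j < length vs" "i' < length vs" "j' < length vs" "i \<noteq> j"
        using xy(1,2) adj_i(2) ne by (auto simp: A_def)
      have "vs ! i = vs ! i' \<and> vs ! j = vs ! j' \<or> vs ! i = vs ! j' \<and> vs ! j = vs ! i'"
        "i < j \<longleftrightarrow> i' < j'"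
        using xy(3) by (auto simp: g_def doubleton_eq_iff)
      then show "x = y" using vs(1) lt by (auto simp: nth_eq_iff_index_eq)
    qed
    show "g ` A \<subseteq> E \<times> UNIV" using adj_i(2) by (auto simp: A_def g_def)
  qed (use \<open>finite E\<close> in simp)
  also have "\<dots> = 2 * card E" by (simp add: card_cartesian_product)
  finally show ?thesis .
qed

text \<open>The constant \<open>c\<close> majorizes the numbers of states and levels and all
  possible outputs, so that they fit into a word of \<open>(N + 2) ^ c\<close> also for tiny
  graphs. The recorded graph is isomorphic to the given one; both inequalities come from
  monotonicity, applied to the numbering of the vertices and to its inverse.\<close>

theorem parameter_fixed_parameter_linear:
  assumes f: "subgraph_monotone f" "bounded_by_height f"
  shows "nonuniformly_fixed_parameter_linear tree_depth f"
  unfolding nonuniformly_fixed_parameter_linear_def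
proof
  fix d :: nat
  define D where "D = (2::nat) ^ d"
  obtain K and code :: "nat tree \<Rightarrow> nat" and node link hang out
    where code: "\<And>t. code t < K" "\<And>v. code (Node v) = node"
      "\<And>t j. code (Link t j) = link (code t) j" "\<And>t c. code (Hang t c) = hang (code t) (code c)"
    and out: "\<And>t. bounded_tree D 0 t \<Longrightarrow> distinct_tree t \<Longrightarrow>
      out (code t) = f (verts_below t) (edges_below t)"
    by (rule finite_state_parameter[OF f, of D]) (rule that)
  define cost where "cost = 2 * K + D + 20"
  define c where "c = 4 * cost + (\<Sum>a<K. out a)"
  let ?P = "evaluate K node link hang out D"
  show "linear_time_computable_on (\<lambda>V E. tree_depth V E \<le> d) f"
    unfolding linear_time_computable_on_def Let_def
  proof (rule exI[of _ ?P], rule exI[of _ c], intro allI impI)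
    fix V :: "nat set" and E vs adj
    assume G: "simple_graph V E" and td: "tree_depth V E \<le> d" and adj: "adjacency_lists V E vs adj"
    define N where "N = card V + card E"
    define w where "w = (N + 2) ^ c"
    have vs: "distinct vs" "set vs = V" "length adj = length vs"
      and adj_i: "\<And>i. i < length vs \<Longrightarrow> set (adj ! i) = {j. j < length vs \<and> {vs ! i, vs ! j} \<in> E}"
      using adj unfolding adjacency_lists_def by blast+
    have len: "length vs = card V" using distinct_card[OF vs(1)] vs(2) by simp
    have concat: "length (concat adj) \<le> 2 * card E" by (rule adjacency_length[OF G adj])
    have cw: "c \<le> w"
    proof -
      have "c < 2 ^ c" by (rule less_exp)
      also have "\<dots> \<le> w" unfolding w_def by (rule power_mono) simp_all
      finally show ?thesis by simp
    qed
    have Nw: "2 * N \<le> w"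
    proof -
      have "2 * N \<le> (N + 2) ^ 2" by (simp add: power2_eq_square)
      also have "\<dots> \<le> w" unfolding w_def by (rule power_increasing) (simp_all add: c_def cost_def)
      finally show ?thesis .
    qed
    interpret dfs: depth_first_search adj w D K code node link hang
    proof
      show "j < length adj" if "i < length adj" "j \<in> set (adj ! i)" for i j
        using that vs(3) adj_i by auto
      show "i \<in> set (adj ! j)" if "i < length adj" "j \<in> set (adj ! i)" for i j
        using that vs(3) adj_i by (auto simp: insert_commute)
      show "i \<notin> set (adj ! i)" if "i < length adj" for i
        using that vs(3) adj_i G by (auto simp: simple_graph_def)
      show "length p \<le> D" if p: "distinct p" "set p \<subseteq> {..<length adj}"
        "successively (\<lambda>u v. v \<in> set (adj ! u)) p" for p
      proof -
        have "successively (\<lambda>u v. {vs ! u, vs ! v} \<in> E) p"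
          using p(3) by (rule successively_mono) (use p(2) vs(3) adj_i in auto)
        then have "successively (\<lambda>u v. {u, v} \<in> E) (map ((!) vs) p)"
          by (simp add: successively_map)
        moreover have "distinct (map ((!) vs) p)"
          using p(1,2) vs(3) inj_on_nth[OF vs(1), of "set p"] by (auto simp: distinct_map)
        moreover have "set (map ((!) vs) p) \<subseteq> V" using p(2) vs(2,3) by auto
        ultimately have "length (map ((!) vs) p) < 2 ^ d"
          by (intro tree_depth_path_length[OF G td])
        then show ?thesis by (simp add: D_def)
      qed
      show "length adj \<le> w" using Nw len vs(3) by (simp add: N_def)
      show "length (concat adj) \<le> w" using Nw concat by (simp add: N_def)
      show "Suc D \<le> w" "K \<le> w" using cw by (simp_all add: c_def cost_def)
    qed (fact code)+
    have "out a \<le> w" if "a < K" for a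
    proof -
      have "out a \<le> (\<Sum>a<K. out a)" using that by (intro member_le_sum) auto
      then show ?thesis using cw by (simp add: c_def)
    qed
    then obtain s' t T where run: "runs w ?P (input_memory adj) T s'"
      and T: "T \<le> dfs.cost * (dfs.n + dfs.work {..<dfs.n} + 1)" and s': "s' 3 0 = out (code t)"
      and t: "bounded_tree D 0 t" "distinct_tree t" "verts_below t = {..<dfs.n}"
        "edges_below t = dfs.incident {..<dfs.n}"
      using dfs.evaluate_correct[of out] by blast
    have n: "dfs.n = length vs" by (simp add: dfs.n_def vs(3))
    have "T \<le> c * (N + 1)"
    proof -
      have "dfs.n + dfs.work {..<dfs.n} + 1 \<le> 2 * (N + 1)"
        unfolding dfs.work_all using concat len by (simp add: n N_def)
      then have "T \<le> cost * (2 * (N + 1))"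
        using T mult_le_mono2 le_trans unfolding dfs.cost_def dfs.iter_cost_def cost_def
        by (metis (no_types, lifting) add.assoc numeral_plus_numeral numeral_Bit0 semiring_norm(5) add_numeral_left)
      also have "\<dots> \<le> c * (N + 1)" by (simp add: c_def algebra_simps)
      finally show ?thesis .
    qed
    moreover have "out (code t) = f V E"
    proof -
      let ?W = "verts_below t" and ?F = "edges_below t"
      have H: "simple_graph ?W ?F" using t(1,2) by (rule simple_graph_below)
      have F: "?F = {{i, j} | i j. i < length vs \<and> j < length vs \<and> {vs ! i, vs ! j} \<in> E}"
        unfolding t(4) n dfs.incident_def dfs.nb_def using adj_i by auto
      have inj: "inj_on ((!) vs) ?W" using vs(1) by (auto simp: t(3) n inj_on_def nth_eq_iff_index_eq)
      have img: "(!) vs ` ?W = V" unfolding t(3) n vs(2)[symmetric] by (auto simp: set_conv_nth)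
      have "graph_embedding ((!) vs) ?W ?F V E"
        using inj img by (auto simp: graph_embedding_def F)
      then have le: "f ?W ?F \<le> f V E" using f(1) H G by (auto simp: subgraph_monotone_def)
      let ?\<psi> = "inv_into ?W ((!) vs)"
      have "?\<psi> ` e \<in> ?F" if "e \<in> E" for e
      proof -
        have "card e = 2" "e \<subseteq> V" using G that by (auto simp: simple_graph_def)
        then obtain a b where e: "e = {a, b}" "a \<in> V" "b \<in> V" by (auto simp: card_2_iff)
        then obtain i j where ij: "i < length vs" "j < length vs" "vs ! i = a" "vs ! j = b"
          using vs(2) by (metis in_set_conv_nth)
        then have "?\<psi> a = i" "?\<psi> b = j"
          using inv_into_f_f[OF inj, of i] inv_into_f_f[OF inj, of j] by (auto simp: t(3) n)
        then have eq: "?\<psi> ` e = {i, j}" by (simp add: e(1))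
        have "{vs ! i, vs ! j} \<in> E" using ij e(1) that by simp
        then show ?thesis unfolding eq F using ij(1,2) by blast
      qed
      then have "graph_embedding ?\<psi> V E ?W ?F"
        using inj_on_inv_into[of V "(!) vs" ?W] inv_into_into[of _ "(!) vs" ?W] img
        by (auto simp: graph_embedding_def)
      then have "f V E \<le> f ?W ?F" using f(1) H G by (auto simp: subgraph_monotone_def)
      then show ?thesis using le out[OF t(1,2)] by simp
    qed
    ultimately show "\<exists>t s. exec ((card V + card E + 2) ^ c) ?P (input_memory adj) t s \<and>
        t \<le> c * (card V + card E + 1) \<and> s 3 0 = f V E"
      using run s' unfolding runs_def w_def N_def by (metis le_trans)
  qed
qed

theorem theorem23:
  shows "nonuniformly_fixed_parameter_linear tree_depth track_number \<and>
         nonuniformly_fixed_parameter_linear tree_depth layered_pathwidth"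
  using parameter_fixed_parameter_linear track_number_parameter layered_pathwidth_parameter
  by blast

end
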